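(* For any integer $n\ge2$, any $p\ge1$ and any Hölder exponent $\alpha\in(0,1]$ with $\alpha<\frac{p(n-1)}{n}$, there is $v\in C^{0,\alpha}(B_1,\mathbb{R}^n)$ such that $\deg(v,B_1,\cdot)\notin L^p(\mathbb{R}^n)$, where $B_1\subset\mathbb{R}^n$ is the unit ball.
   Context: $C^{0,\alpha}(B_1,\mathbb{R}^n)$ is the space of $\alpha$-Hölder maps on the open unit ball $B_1$; such $v$ extends uniquely to a continuous map on $\overline{B_1}$, still denoted $v$. $\deg(v,B_1,y)$ is the Brouwer degree, defined for $y\in\mathbb{R}^n\setminus v(\partial B_1)$; to regard it as a function on $\mathbb{R}^n$, set it equal to $0$ on $v(\partial B_1)$. *)

theory Defs
  imports "HOL-Analysis.Analysis" "HOL-Homology.Homology"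
begin

text \<open>On a bounded set \<open>U\<close> the bound below already forces \<open>v\<close> to be bounded, so for the unit ball
  this is the whole space of \<open>\<alpha>\<close>-Hoelder maps, without a separate boundedness condition.\<close>

definition holder_space :: "real \<Rightarrow> 'a::metric_space set \<Rightarrow> ('a \<Rightarrow> 'b::metric_space) set" where
  "holder_space \<alpha> U =
     {v. \<exists>C. \<forall>x\<in>U. \<forall>y\<in>U. dist (v x) (v y) \<le> C * dist x y powr \<alpha>}"

text \<open>For uniformly continuous \<open>v\<close> on \<open>U\<close>, this is the unique continuous extension of \<open>v\<close> to the
  closure of \<open>U\<close>; values of \<open>v\<close> outside \<open>U\<close> are not used on the closure.\<close>

definition closure_extension ::
    "'a::topological_space set \<Rightarrow> ('a \<Rightarrow> 'b::t2_space) \<Rightarrow> 'a \<Rightarrow> 'b" where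
  "closure_extension U v x = (if x \<in> U then v x else Lim (at x within U) v)"

text \<open>The Brouwer degree on the unit ball \<open>B\<close> of an \<open>n\<close>-dimensional Euclidean space \<open>E\<close>, for \<open>f\<close>
  continuous on the closed ball and \<open>y\<close> outside \<open>f(\<partial>B)\<close>. The map \<open>x \<mapsto> f x - y\<close> and the
  inclusion both induce homomorphisms \<open>H\<^sub>n(cl B, \<partial>B) \<rightarrow> H\<^sub>n(E, E - {0})\<close>. These groups are
  infinite cyclic and the inclusion induces an isomorphism, so the first homomorphism is a unique
  integer multiple of the second (the groups are written multiplicatively), and this integer is
  the degree. Measuring against the inclusion fixes the sign, so the identity has degree \<open>1\<close> at
  points of \<open>B\<close>. On \<open>f(\<partial>B)\<close> the value is \<open>0\<close> by convention.\<close>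

definition ball_degree :: "('a::euclidean_space \<Rightarrow> 'a) \<Rightarrow> 'a \<Rightarrow> int" where
  "ball_degree f y =
     (if y \<in> f ` sphere 0 1 then 0
      else (THE d::int.
        \<forall>a \<in> carrier (relative_homology_group (int DIM('a)) (top_of_set (cball 0 1)) (sphere 0 1)).
          hom_induced (int DIM('a)) (top_of_set (cball 0 1)) (sphere 0 1) euclidean (- {0})
            (\<lambda>x. f x - y) a
          = hom_induced (int DIM('a)) (top_of_set (cball 0 1)) (sphere 0 1) euclidean (- {0}) id a
            [^]\<^bsub>relative_homology_group (int DIM('a)) euclidean (- {0::'a})\<^esub> d))"

text \<open>The definite description in the definition is never vacuous.\<close>

lemma hom_multiple_of_iso_unique:
  assumes G: "group G" and H: "group H" and Z: "G \<cong> integer_group"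
    and f: "f \<in> iso G H" and h: "h \<in> hom G H"
  shows "\<exists>!d::int. \<forall>a\<in>carrier G. h a = f a [^]\<^bsub>H\<^esub> d"
proof -
  interpret G: group G by fact
  interpret H: group H by fact
  interpret f: group_hom G H f using f by (simp add: group_hom_def group_hom_axioms_def G H iso_def)
  interpret h: group_hom G H h using h by (simp add: group_hom_def group_hom_axioms_def G H)
  obtain k where k: "k \<in> iso integer_group G"
    using G.iso_sym[OF Z] by (auto simp: is_iso_def)
  interpret k: group_hom integer_group G k using k by (simp add: group_hom_def group_hom_axioms_def G iso_def)
  have kp: "k n = k 1 [^]\<^bsub>G\<^esub> n" for n
    using k.hom_int_pow[of 1 n] by simp
  define e where "e = f \<circ> k"
  have bk: "bij_betw k UNIV (carrier G)" and bf: "bij_betw f (carrier G) (carrier H)"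
    using k f by (auto simp: iso_def)
  have be: "bij_betw e UNIV (carrier H)" unfolding e_def using bk bf by (rule bij_betw_trans)
  have ep: "e n = e 1 [^]\<^bsub>H\<^esub> n" for n
    unfolding e_def o_def by (metis UNIV_I carrier_integer_group f.hom_int_pow k.hom_closed kp)
  have k1: "k 1 \<in> carrier G" by auto
  obtain d where d: "h (k 1) = e d" 
    using h.hom_closed[OF k1] bij_betw_imp_surj_on[OF be] by blast
  have "h a = f a [^]\<^bsub>H\<^esub> d" if a: "a \<in> carrier G" for a
  proof -
    obtain n where n: "a = k n" using bij_betw_imp_surj_on[OF bk] a by blast
    have "h a = h (k 1) [^]\<^bsub>H\<^esub> n" 
      unfolding n by (subst kp) (rule h.hom_int_pow[OF k1])
    also have "\<dots> = e 1 [^]\<^bsub>H\<^esub> (d * n)" using d ep[of d] by (simp add: H.int_pow_pow e_def)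
    also have "\<dots> = f a [^]\<^bsub>H\<^esub> d"
      using n ep[of n] by (simp add: e_def H.int_pow_pow mult.commute)
    finally show ?thesis .
  qed
  moreover have "d' = d" if "\<forall>a\<in>carrier G. h a = f a [^]\<^bsub>H\<^esub> d'" for d'
  proof -
    have "e d' = e d" using that k1 d ep[of d'] by (simp add: e_def)
    then show ?thesis using be by (auto simp: bij_betw_def inj_on_def)
  qed
  ultimately show ?thesis by blast
qed

lemma ball_degree_unique:
  fixes f :: "'a::euclidean_space \<Rightarrow> 'a"
  shows "\<exists>!d::int. \<forall>a \<in> carrier (relative_homology_group (int DIM('a)) (top_of_set (cball 0 1)) (sphere 0 1)).
          hom_induced (int DIM('a)) (top_of_set (cball 0 1)) (sphere 0 1) euclidean (- {0})
            (\<lambda>x. f x - y) a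
          = hom_induced (int DIM('a)) (top_of_set (cball 0 1)) (sphere 0 1) euclidean (- {0}) id a
            [^]\<^bsub>relative_homology_group (int DIM('a)) euclidean (- {0::'a})\<^esub> d"
proof (rule hom_multiple_of_iso_unique)
  let ?n = "int DIM('a)"
  let ?B = "top_of_set (cball (0::'a) 1)" and ?S = "sphere (0::'a) 1"
  have cB: "contractible_space ?B"
    by (simp add: contractible_space_top_of_set convex_imp_contractible)
  have cE: "contractible_space (euclidean :: 'a topology)"
    by (metis contractible_space_top_of_set convex_imp_contractible convex_UNIV subtopology_UNIV)
  have sub: "subtopology ?B ?S = top_of_set ?S"
    by (simp add: subtopology_subtopology Int_absorb1)
  have ne: "?S \<noteq> {}" by simp
  have b1: "hom_boundary ?n ?B ?S \<in> iso (relative_homology_group ?n ?B ?S) (reduced_homology_group (?n - 1) (top_of_set ?S))"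
    using iso_relative_homology_of_contractible[OF cB, of ?S ?n] ne unfolding sub by (auto simp: Int_absorb1)
  have b2: "hom_boundary ?n euclidean (-{0::'a}) \<in> iso (relative_homology_group ?n euclidean (-{0::'a})) (reduced_homology_group (?n - 1) (top_of_set (-{0::'a})))"
    by (rule iso_relative_homology_of_contractible[OF cE]) (use ne in force)
  have inc: "hom_induced (?n-1) (top_of_set ?S) {} (top_of_set (-{0::'a})) {} id
     \<in> iso (reduced_homology_group (?n - 1) (top_of_set ?S)) (reduced_homology_group (?n - 1) (top_of_set (-{0::'a})))"
  proof (rule homotopy_equivalence_reduced_homology_group_isomorphism)
    let ?g = "\<lambda>x::'a. x /\<^sub>R norm x"
    show "continuous_map (top_of_set ?S) (top_of_set (-{0::'a})) id" by auto
    show g: "continuous_map (top_of_set (-{0::'a})) (top_of_set ?S) ?g"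
      by (auto intro!: continuous_intros)
    show "homotopic_with (\<lambda>h. True) (top_of_set ?S) (top_of_set ?S) (?g \<circ> id) id"
      by (rule homotopic_with_equal) (auto simp: image_subset_iff intro!: continuous_intros)
    show "homotopic_with (\<lambda>k. True) (top_of_set (-{0::'a})) (top_of_set (-{0::'a})) (id \<circ> ?g) id"
    proof (rule homotopic_with_linear)
      show "closed_segment ((id \<circ> ?g) x) (id x) \<subseteq> -{0}" if "x \<in> -{0}" for x
      proof -
        have "(1-u) *\<^sub>R (x /\<^sub>R norm x) + u *\<^sub>R x \<noteq> 0" if u: "0 \<le> u" "u \<le> 1" for u
        proof -
          have "(1-u) *\<^sub>R (x /\<^sub>R norm x) + u *\<^sub>R x = ((1-u)/norm x + u) *\<^sub>R x"
            by (simp add: algebra_simps divide_inverse)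
          moreover have "(1-u)/norm x + u > 0"
            using u \<open>x \<in> -{0}\<close> by (cases "u = 0") (auto intro: add_nonneg_pos)
          ultimately show ?thesis using \<open>x \<in> -{0}\<close> by auto
        qed
        then show ?thesis by (auto simp: closed_segment_def) 
      qed
    qed (auto intro!: continuous_intros)
  qed
  let ?i = "hom_induced ?n ?B ?S euclidean (- {0}) id"
  have nat: "hom_boundary ?n euclidean (-{0::'a}) \<circ> ?i = hom_induced (?n-1) (top_of_set ?S) {} (top_of_set (-{0::'a})) {} id \<circ> hom_boundary ?n ?B ?S"
    
  proof -
    have "id \<in> ?S \<rightarrow> -{0}" by (intro funcsetI) auto
    then show ?thesis
      using naturality_hom_induced[of ?B euclidean id ?S "-{0}" ?n] unfolding sub by simp
  qed
  let ?G = "relative_homology_group ?n ?B ?S" and ?H = "relative_homology_group ?n euclidean (-{0::'a})"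
  show ih: "hom_induced ?n ?B ?S euclidean (- {0}) (\<lambda>x. f x - y) \<in> hom ?G ?H"
    by (rule hom_induced_hom)
  have comp: "hom_boundary ?n euclidean (-{0::'a}) \<circ> ?i \<in> iso ?G (reduced_homology_group (?n - 1) (top_of_set (-{0::'a})))"
    unfolding nat using b1 inc by (rule iso_set_trans)
  show "?i \<in> iso ?G ?H"
  proof -
    have c: "?i x \<in> carrier ?H" for x by (rule hom_induced_carrier)
    have bb: "bij_betw (hom_boundary ?n euclidean (-{0::'a})) (carrier ?H) (carrier (reduced_homology_group (?n - 1) (top_of_set (-{0::'a}))))"
      using b2 by (simp add: iso_def)
    have bc: "bij_betw (hom_boundary ?n euclidean (-{0::'a}) \<circ> ?i) (carrier ?G) (carrier (reduced_homology_group (?n - 1) (top_of_set (-{0::'a}))))"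
      using comp by (simp add: iso_def)
    have "bij_betw ?i (carrier ?G) (carrier ?H)"
      by (subst bij_betw_comp_iff2[OF bb]) (use c bc in auto)
    then show ?thesis by (simp add: iso_def hom_induced_hom)
  qed
  have "DIM('a) \<noteq> 0" using DIM_positive[where 'a='a] by linarith
  then obtain g :: "(nat \<Rightarrow> real) \<Rightarrow> 'a" and h
    where "homeomorphic_maps (nsphere (DIM('a) - 1)) (top_of_set (?S \<inter> span Basis)) g h"
    by (rule homeomorphic_maps_nsphere_euclidean_sphere
          [OF independent_Basis orthogonal_Basis refl _ norm_Basis])
  then have "homeomorphic_maps (nsphere (DIM('a) - 1)) (top_of_set ?S) g h"
    by simp
  then have "top_of_set ?S homeomorphic_space nsphere (DIM('a) - 1)"
    unfolding homeomorphic_space_sym[of "top_of_set ?S"] by (auto simp: homeomorphic_space_def)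
  then have "reduced_homology_group (?n - 1) (top_of_set ?S) \<cong>
      reduced_homology_group (?n - 1) (nsphere (DIM('a) - 1))"
    by (rule homeomorphic_space_imp_isomorphic_reduced_homology_groups)
  moreover have "reduced_homology_group (?n - 1) (nsphere (DIM('a) - 1)) \<cong> integer_group"
  proof -
    have eq: "?n - 1 = int (DIM('a) - 1)" using DIM_positive[where 'a='a] by linarith
    show ?thesis unfolding eq by (rule reduced_homology_group_nsphere(1))
  qed
  ultimately have "reduced_homology_group (?n - 1) (top_of_set ?S) \<cong> integer_group"
    by (rule iso_trans)
  then show "?G \<cong> integer_group" by (rule iso_trans[OF is_isoI[OF b1]])
qed (rule group_relative_homology_group)+

text \<open>The real-valued \<open>p\<close>-integrable functions for finite \<open>p\<close>, as functions rather than
  almost-everywhere equivalence classes.\<close>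

definition Lp_space :: "real \<Rightarrow> 'a measure \<Rightarrow> ('a \<Rightarrow> real) set" where
  "Lp_space p M = {f \<in> borel_measurable M. integrable M (\<lambda>x. \<bar>f x\<bar> powr p)}"

end

theory Submission
  imports Defs
begin

text \<open>The degree is made large on small cubes. A pillow (the double of an \<open>(n - 1)\<close>-cube, realised as a sphere
  in \<open>\<real>\<^sup>n\<close>) has a self-map folding the cube in two along every direction; it doubles distances at most and
  has degree \<open>2\<^bsup>n-1\<^esup>\<close>, so its \<open>m\<close>-th iterate has Lipschitz constant \<open>2\<^bsup>m\<^esup>\<close> and degree \<open>2\<^bsup>m(n-1)\<^esup>\<close>.
  Wrap a patch of radius \<open>r\<close> of the sphere around a pillow of size \<open>s = (2\<^bsup>-m\<^esup> r)\<^bsup>\<alpha>\<^esup>\<close> through this iterate: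
  the \<open>\<alpha>\<close>-Hoelder constant stays bounded independently of \<open>m\<close>, while the contribution to the integral of the
  \<open>p\<close>-th power of the degree is of order \<open>2\<^bsup>m(n-1)p\<^esup> s\<^bsup>n\<^esup>\<close>, which is unbounded in \<open>m\<close> precisely because
  \<open>\<alpha> n < p (n - 1)\<close>. Infinitely many disjoint patches whose pillows are strung along a line, with \<open>m\<close> chosen
  larger and larger, make the integral infinite.

  The degree of the folding maps reduces to that of squaring in a coordinate plane, which is found by comparing
  the contributions of two hemispheres.\<close>

section \<open>Doubling the degree on the standard sphere\<close>

text \<open>The degree sees \<open>v\<close> only through its values on the unit sphere, which has
  dimension n-1. A map of Lipschitz constant L can therefore multiply the degree by L^(n-1), not by
  L^n, and this is where the exponent n-1 comes from. Folding attains this growth by an explicit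
  formula, which is the advantage of a pillow over a round sphere. The obstacle is the degree of a
  map carrying infinitely many bubbles. Instead of localising the degree, for each value
  \<open>y\<close> deep inside the k-th pillow a homotopy deforms everything else away without
  meeting \<open>y\<close>. To make room for it, the pillows hang by a corner on the z-axis, at the
  heights \<open>r k\<close> and in disjoint slabs, and \<open>y\<close> is kept off the axis. The
  other bubbles then move only horizontally, inside their own slabs, until they lie on the axis, and
  the axis can be contracted. Nearly all homotopies are straight lines, so most degree computations
  reduce to excluding that two vectors point in opposite directions.\<close>

lemma relative_homology_split_hemispheres:
  assumes a: "a \<in> carrier (relative_homology_group q (nsphere n) {x. x k = 0})"
  obtains b c where
    "b \<in> carrier (relative_homology_group q (subtopology (nsphere n) {x. x k \<ge> 0}) {x. x k = 0})"
    "c \<in> carrier (relative_homology_group q (subtopology (nsphere n) {x. x k \<le> 0}) {x. x k = 0})"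
    "a = hom_induced q (subtopology (nsphere n) {x. x k \<ge> 0}) {x. x k = 0} (nsphere n) {x. x k = 0} id b
       \<otimes>\<^bsub>relative_homology_group q (nsphere n) {x. x k = 0}\<^esub>
         hom_induced q (subtopology (nsphere n) {x. x k \<le> 0}) {x. x k = 0} (nsphere n) {x. x k = 0} id c"
proof -
  let ?X = "nsphere n" and ?E = "{x::nat\<Rightarrow>real. x k = 0}"
  let ?U = "{x::nat\<Rightarrow>real. x k \<ge> 0}" and ?L = "{x::nat\<Rightarrow>real. x k \<le> 0}"
  let ?G = "relative_homology_group q ?X ?E" and ?GL = "relative_homology_group q ?X ?L"
  let ?r = "hom_induced q ?X ?E ?X ?L id"
  let ?iU = "hom_induced q (subtopology ?X ?U) ?E ?X ?E id"
  let ?iL = "hom_induced q (subtopology ?X ?L) ?E ?X ?E id"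
  interpret G: group ?G by simp
  interpret GL: group ?GL by simp
  interpret r: group_hom ?G ?GL ?r
    by (simp add: group_hom_def group_hom_axioms_def hom_induced_hom)
  have "?r a \<in> carrier ?GL" by (rule hom_induced_carrier)
  \<comment> \<open>Excision: the upper hemisphere relative to the equator has the homology of the
    sphere relative to the lower hemisphere.\<close>
  then obtain b where b: "b \<in> carrier (relative_homology_group q (subtopology ?X ?U) ?E)"
    and rb: "?r a = hom_induced q (subtopology ?X ?U) ?E ?X ?L id b"
    using iso_relative_homology_group_upper_hemisphere[of q n k, unfolded iso_def bij_betw_def]
    by blast
  have cU: "continuous_map (subtopology ?X ?U) ?X id" by (simp add: continuous_map_from_subtopology)
  have "?r (?iU b) = hom_induced q (subtopology ?X ?U) ?E ?X ?L (id \<circ> id) b"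
    by (rule hom_induced_compose'[OF cU]) auto
  then have eq: "?r (?iU b) = ?r a" using rb by simp
  have iUc: "?iU b \<in> carrier ?G" by (rule hom_induced_carrier)
  have "inv\<^bsub>?G\<^esub> (?iU b) \<otimes>\<^bsub>?G\<^esub> a \<in> kernel ?G ?GL ?r"
    using a iUc eq by (auto simp: kernel_def)
  \<comment> \<open>Exactness for the triple of sphere, lower hemisphere and equator.\<close>
  moreover have "kernel ?G ?GL ?r = ?iL ` carrier (relative_homology_group q (subtopology ?X ?L) ?E)"
  proof -
    have "?E \<subseteq> ?L" by auto
    from homology_exactness_triple_3[OF this, of q ?X] show ?thesis by simp
  qed
  ultimately obtain c where c: "c \<in> carrier (relative_homology_group q (subtopology ?X ?L) ?E)"
    and ca: "inv\<^bsub>?G\<^esub> (?iU b) \<otimes>\<^bsub>?G\<^esub> a = ?iL c" by auto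
  have "a = ?iU b \<otimes>\<^bsub>?G\<^esub> ?iL c"
    using a iUc unfolding ca[symmetric] by (simp add: G.m_assoc[symmetric])
  then show ?thesis using that b c by blast
qed

text \<open>The two halves of a fundamental class have the same image under \<open>G\<close>, because \<open>A\<close> swaps the
  hemispheres; replacing \<open>G\<close> by \<open>P\<close> kills the contribution of one half, since \<open>P\<close>
  maps the lower hemisphere into a contractible set.\<close>

lemma Brouwer_degree2_double:
  assumes jn: "j \<le> n"
    and cG: "continuous_map (nsphere n) (nsphere n) G"
    and cP: "continuous_map (nsphere n) (nsphere n) P"
    and cA: "continuous_map (nsphere n) (nsphere n) A"
    and dA: "Brouwer_degree2 n A = 1"
    and Ak: "\<And>x. x \<in> topspace (nsphere n) \<Longrightarrow> A x k = - x k"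
    and GA: "\<And>x. x \<in> topspace (nsphere n) \<Longrightarrow> G (A x) = G x"
    and PG: "\<And>x. x \<in> topspace (nsphere n) \<Longrightarrow> x k \<ge> 0 \<Longrightarrow> P x = G x"
    and Pj: "\<And>x. x \<in> topspace (nsphere n) \<Longrightarrow> x k \<le> 0 \<Longrightarrow> P x j \<ge> 0"
  shows "Brouwer_degree2 n G = 2 * Brouwer_degree2 n P"
proof (rule Brouwer_degree2_unique[OF cG])
  let ?q = "int n"
  let ?X = "nsphere n" and ?E = "topspace (nsphere n) \<inter> {x::nat\<Rightarrow>real. x k = 0}"
  let ?D = "{x::nat\<Rightarrow>real. x j \<ge> 0}"
  let ?H = "{x::nat\<Rightarrow>real. x k \<ge> 0}" and ?L = "{x::nat\<Rightarrow>real. x k \<le> 0}"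
  let ?R = "reduced_homology_group ?q ?X"
  let ?GE = "relative_homology_group ?q ?X ?E" and ?GD = "relative_homology_group ?q ?X ?D"
  let ?s = "hom_induced ?q ?X {} ?X ?E id" and ?t = "hom_induced ?q ?X {} ?X ?D id"
  interpret R: group ?R by simp
  interpret GD: group ?GD by simp
  interpret t: group_hom ?R ?GD ?t
    using iso_reduced_homology_group_upper_hemisphere[OF jn, of ?q]
    by (simp add: group_hom_def group_hom_axioms_def iso_def)
  \<comment> \<open>Degrees are compared in the homology relative to the hemisphere
    \<open>?D\<close>: the fundamental class survives there, while anything mapped into
    \<open>?D\<close> is killed.\<close>
  have inj: "inj_on ?t (carrier ?R)"
    using iso_reduced_homology_group_upper_hemisphere[OF jn, of ?q] by (auto simp: iso_def bij_betw_def)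
  have push: "hom_induced ?q ?X ?E ?X ?D F (?s a) = ?t a [^]\<^bsub>?GD\<^esub> Brouwer_degree2 n F"
    if cF: "continuous_map ?X ?X F" and F: "\<And>x. x \<in> ?E \<Longrightarrow> F x j \<ge> 0" and a: "a \<in> carrier ?R" for F a
  proof -
    have "hom_induced ?q ?X ?E ?X ?D F (?s a) = hom_induced ?q ?X {} ?X ?D (F \<circ> id) a"
      by (rule hom_induced_compose') (use cF F in auto)
    also have "\<dots> = hom_induced ?q ?X {} ?X ?D (id \<circ> F) a" by simp
    also have "\<dots> = ?t (hom_induced ?q ?X {} ?X {} F a)"
      by (rule hom_induced_compose'[symmetric]) (use cF in auto)
    also have "\<dots> = ?t a [^]\<^bsub>?GD\<^esub> Brouwer_degree2 n F"
      using a by (simp add: Brouwer_degree2 t.hom_int_pow)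
    finally show ?thesis .
  qed
  \<comment> \<open>Such an \<open>F\<close> factors through the pair \<open>(?Y, ?D)\<close>, whose
    subset is the whole space \<open>?Y\<close>, so that its homology is trivial.\<close>
  have triv: "hom_induced ?q (subtopology ?X V) ?E ?X ?D F c = \<one>\<^bsub>?GD\<^esub>"
    if cF: "continuous_map ?X ?X F" and F: "\<And>x. x \<in> topspace ?X \<inter> V \<Longrightarrow> F x j \<ge> 0" and E: "?E \<subseteq> V" for F V c
  proof -
    let ?Y = "subtopology ?X ?D"
    have 1: "continuous_map (subtopology ?X V) ?Y F"
      using cF F by (auto simp: continuous_map_in_subtopology continuous_map_from_subtopology)
    have "hom_induced ?q (subtopology ?X V) ?E ?X ?D (id \<circ> F) c
       = hom_induced ?q ?Y ?D ?X ?D id (hom_induced ?q (subtopology ?X V) ?E ?Y ?D F c)"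
      by (rule hom_induced_compose'[symmetric])
        (use 1 F E in \<open>auto simp: continuous_map_from_subtopology\<close>)
    moreover have "hom_induced ?q (subtopology ?X V) ?E ?Y ?D F c = \<one>\<^bsub>relative_homology_group ?q ?Y ?D\<^esub>"
    proof -
      have "trivial_group (relative_homology_group ?q ?Y (topspace ?Y))"
        by (rule trivial_relative_homology_group_topspace)
      moreover have "relative_homology_group ?q ?Y (topspace ?Y) = relative_homology_group ?q ?Y ?D"
      proof -
        have "topspace ?Y \<inter> ?D = topspace ?Y" by auto
        then show ?thesis using relative_homology_group_restrict[of ?q ?Y ?D] by (simp only:)
      qed
      ultimately have "carrier (relative_homology_group ?q ?Y ?D) = {\<one>\<^bsub>relative_homology_group ?q ?Y ?D\<^esub>}"
        by (simp only: trivial_group_def)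
      then show ?thesis
        using hom_induced_carrier[of ?q "subtopology ?X V" ?E ?Y ?D F c] by blast
    qed
    ultimately show ?thesis
      using hom_one[OF hom_induced_hom[of ?q ?Y ?D ?X ?D id]] by simp
  qed
  fix a assume a: "a \<in> carrier ?R"
  have sa: "?s a \<in> carrier (relative_homology_group ?q ?X {x. x k = 0})"
    using hom_induced_carrier[of ?q ?X "{}" ?X ?E id a] unfolding relative_homology_group_restrict .
  have REeq: "relative_homology_group ?q ?X {x. x k = 0} = ?GE" by simp
  obtain b c where
    sbc: "?s a = hom_induced ?q (subtopology ?X ?H) {x. x k = 0} ?X {x. x k = 0} id b
       \<otimes>\<^bsub>?GE\<^esub> hom_induced ?q (subtopology ?X ?L) {x. x k = 0} ?X {x. x k = 0} id c"
    using relative_homology_split_hemispheres[OF sa] unfolding REeq by metis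
  have hE: "hom_induced ?q (subtopology ?X V) {x. x k = 0} ?X {x. x k = 0} id
          = hom_induced ?q (subtopology ?X V) ?E ?X ?E id" if "{x. x k = 0} \<subseteq> V" for V
  proof -
    have "topspace (subtopology ?X V) \<inter> {x. x k = 0} = ?E" using that by auto
    then show ?thesis by (metis hom_induced_restrict)
  qed
  let ?b = "hom_induced ?q (subtopology ?X ?H) ?E ?X ?E id b"
  let ?c = "hom_induced ?q (subtopology ?X ?L) ?E ?X ?E id c"
  have sbc': "?s a = ?b \<otimes>\<^bsub>?GE\<^esub> ?c" 
  proof -
    have "{x. x k = 0} \<subseteq> ?H" "{x. x k = 0} \<subseteq> ?L" by auto
    from sbc[unfolded this[THEN hE]] show ?thesis .
  qed
  have split: "hom_induced ?q ?X ?E ?X ?D F (?s a)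
      = hom_induced ?q (subtopology ?X ?H) ?E ?X ?D F b \<otimes>\<^bsub>?GD\<^esub> hom_induced ?q (subtopology ?X ?L) ?E ?X ?D F c"
    if cF: "continuous_map ?X ?X F" and F: "\<And>x. x \<in> ?E \<Longrightarrow> F x j \<ge> 0" for F
  proof -
    have "hom_induced ?q ?X ?E ?X ?D F (?s a)
      = hom_induced ?q ?X ?E ?X ?D F ?b \<otimes>\<^bsub>?GD\<^esub> hom_induced ?q ?X ?E ?X ?D F ?c"
      unfolding sbc' by (rule hom_mult[OF hom_induced_hom]) (rule hom_induced_carrier)+
    moreover have "hom_induced ?q ?X ?E ?X ?D F (hom_induced ?q (subtopology ?X V) ?E ?X ?E id e)
        = hom_induced ?q (subtopology ?X V) ?E ?X ?D F e" for V e
      using hom_induced_compose'[of "subtopology ?X V" ?X id ?E ?E ?X F ?D ?q e] cF F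
      by (force simp: continuous_map_from_subtopology)
    ultimately show ?thesis by simp
  qed
  have Aim: "A x \<in> topspace ?X" if "x \<in> topspace ?X" for x
    using cA that by (auto simp: continuous_map_def)
  have cPA: "continuous_map ?X ?X (P \<circ> A)" using cA cP by (rule continuous_map_compose)
  have PE: "P x j \<ge> 0" if "x \<in> ?E" for x using that Pj by auto
  have GE: "G x j \<ge> 0" if "x \<in> ?E" for x using that PG[of x] PE[of x] by auto
  have PAE: "(P \<circ> A) x j \<ge> 0" if "x \<in> ?E" for x using that Ak Aim Pj by auto
  let ?u = "hom_induced ?q (subtopology ?X ?H) ?E ?X ?D G b"
  let ?w = "hom_induced ?q (subtopology ?X ?L) ?E ?X ?D G c"
  have u: "?u \<in> carrier ?GD" and w: "?w \<in> carrier ?GD" by (rule hom_induced_carrier)+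
  have P1: "hom_induced ?q (subtopology ?X ?H) ?E ?X ?D P = hom_induced ?q (subtopology ?X ?H) ?E ?X ?D G"
    by (rule hom_induced_eq) (auto simp: PG)
  have PA1: "hom_induced ?q (subtopology ?X ?L) ?E ?X ?D (P \<circ> A) = hom_induced ?q (subtopology ?X ?L) ?E ?X ?D G"
    by (rule hom_induced_eq) (auto simp: PG GA Aim Ak)
  have tP: "hom_induced ?q (subtopology ?X ?L) ?E ?X ?D P c = \<one>\<^bsub>?GD\<^esub>"
    by (rule triv[OF cP]) (use Pj in auto)
  have tPA: "hom_induced ?q (subtopology ?X ?H) ?E ?X ?D (P \<circ> A) b = \<one>\<^bsub>?GD\<^esub>"
    by (rule triv[OF cPA]) (use Pj Aim Ak in auto)
  \<comment> \<open>\<open>P\<close> keeps only the contribution of \<open>b\<close> and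
    \<open>P \<circ> A\<close> only that of \<open>c\<close>. Both maps have the same degree because
    \<open>A\<close> has degree 1, and \<open>G\<close> collects the two contributions.\<close>
  have "?t a [^]\<^bsub>?GD\<^esub> Brouwer_degree2 n P = ?u"
    using push[OF cP PE a] split[OF cP PE] GD.r_one[OF u] by (simp only: P1 tP)
  moreover have "?t a [^]\<^bsub>?GD\<^esub> Brouwer_degree2 n (P \<circ> A) = ?w"
    using push[OF cPA PAE a] split[OF cPA PAE] GD.l_one[OF w] by (simp only: PA1 tPA)
  moreover have "Brouwer_degree2 n (P \<circ> A) = Brouwer_degree2 n P"
    by (simp add: Brouwer_degree2_compose[OF cA cP] dA)
  moreover have "?t a [^]\<^bsub>?GD\<^esub> Brouwer_degree2 n G = ?u \<otimes>\<^bsub>?GD\<^esub> ?w"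
    using push[OF cG GE a] split[OF cG GE] by (simp only:)
  ultimately have "?t (a [^]\<^bsub>?R\<^esub> Brouwer_degree2 n G) = ?t (a [^]\<^bsub>?R\<^esub> (2 * Brouwer_degree2 n P))"
    using a t.hom_closed[OF a]
    by (simp only: t.hom_int_pow GD.int_pow_mult mult_2)
  then have "a [^]\<^bsub>?R\<^esub> Brouwer_degree2 n G = a [^]\<^bsub>?R\<^esub> (2 * Brouwer_degree2 n P)"
    using inj a by (simp add: inj_on_def)
  then show "hom_induced ?q ?X {} ?X {} G a = a [^]\<^bsub>?R\<^esub> (2 * Brouwer_degree2 n P)"
    using a by (simp add: Brouwer_degree2)
qed

section \<open>Degree of maps of the Euclidean sphere\<close>

text \<open>\<open>Brouwer_degree2\<close> lives on \<open>nsphere\<close>, whose points are real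
  sequences vanishing beyond the dimension. An arbitrary enumeration of the index type identifies
  the unit sphere of \<open>real^'n\<close> with it.\<close>

definition coord_index :: "'n::finite \<Rightarrow> nat" where
  "coord_index = (SOME h. bij_betw h UNIV {..<CARD('n)})"

lemma bij_coord_index: "bij_betw (coord_index :: 'n::finite \<Rightarrow> nat) UNIV {..<CARD('n)}"
  unfolding coord_index_def
  using someI_ex[OF ex_bij_betw_finite_nat[of "UNIV :: 'n set"]] by (simp add: atLeast0LessThan)

definition to_vec :: "(nat \<Rightarrow> real) \<Rightarrow> real^'n::finite" where
  "to_vec x = (\<chi> i. x (coord_index i))"

definition of_vec :: "real^'n::finite \<Rightarrow> nat \<Rightarrow> real" where
  "of_vec v m = (if m < CARD('n) then v $ (inv_into UNIV coord_index m) else 0)"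

lemma coord_index_less: "coord_index (i::'n::finite) < CARD('n)"
  using bij_coord_index by (auto simp: bij_betw_def)

lemma inv_coord_index [simp]: "inv_into UNIV coord_index (coord_index (i::'n::finite)) = i"
  using bij_coord_index[where 'n='n] by (auto simp: bij_betw_def intro: inv_f_f)

lemma of_vec_coord_index [simp]: "of_vec v (coord_index i) = v $ i"
  by (simp add: of_vec_def coord_index_less)

lemma to_vec_of_vec [simp]: "to_vec (of_vec v) = v"
  by (simp add: to_vec_def vec_eq_iff)

lemma sum_of_vec: "(\<Sum>m<CARD('n). g (of_vec (v::real^'n::finite) m)) = (\<Sum>i\<in>UNIV. g (v $ i))"
  using sum.reindex_bij_betw[OF bij_coord_index[where 'n='n], of "\<lambda>m. g (of_vec v m)"] by simp

lemma topspace_nsphere_CARD: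
  "topspace (nsphere (CARD('n::finite) - 1)) = {x. (\<Sum>m<CARD('n). (x m)\<^sup>2) = 1 \<and> (\<forall>m\<ge>CARD('n). x m = 0)}"
proof -
  have "{..CARD('n) - 1} = {..<CARD('n)}"
    by (metis One_nat_def Suc_pred lessThan_Suc_atMost zero_less_card_finite)
  moreover have "(m > CARD('n) - 1) = (m \<ge> CARD('n))" for m using zero_less_card_finite[where 'a='n] by linarith
  ultimately show ?thesis by (simp add: nsphere)
qed

lemma of_vec_to_vec [simp]:
  assumes "x \<in> topspace (nsphere (CARD('n::finite) - 1))"
  shows "of_vec (to_vec x :: real^'n) = x"
proof
  fix m show "of_vec (to_vec x :: real^'n) m = x m"
    using assms[unfolded topspace_nsphere_CARD] bij_coord_index[where 'n='n]
    by (auto simp: of_vec_def to_vec_def bij_betw_def f_inv_into_f)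
qed

lemma norm_sq_vec: "(norm (v::real^'n::finite))\<^sup>2 = (\<Sum>m<CARD('n). (of_vec v m)\<^sup>2)"
  unfolding sum_of_vec[where g="\<lambda>t. t\<^sup>2"] by (simp add: norm_vec_def L2_set_def sum_nonneg)

lemma of_vec_in_nsphere: "of_vec (v::real^'n::finite) \<in> topspace (nsphere (CARD('n) - 1)) \<longleftrightarrow> norm v = 1"
proof -
  have "norm v = 1 \<longleftrightarrow> (norm v)\<^sup>2 = 1" by (simp add: power2_eq_1_iff) (use norm_ge_zero[of v] in linarith)
  then show ?thesis
    unfolding topspace_nsphere_CARD by (simp add: norm_sq_vec) (simp add: of_vec_def)
qed

lemma to_vec_in_sphere: "x \<in> topspace (nsphere (CARD('n::finite) - 1)) \<Longrightarrow> norm (to_vec x :: real^'n) = 1"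
  using of_vec_in_nsphere[of "to_vec x :: real^'n"] by simp

lemma continuous_on_to_vec: "continuous_on S (to_vec :: _ \<Rightarrow> real^'n::finite)"
  unfolding to_vec_def by (intro continuous_intros) (auto intro: continuous_on_product_then_coordinatewise continuous_on_id)

lemma continuous_on_of_vec: "continuous_on S (of_vec :: real^'n::finite \<Rightarrow> _)"
proof (rule continuous_on_coordinatewise_then_product)
  fix m show "continuous_on S (\<lambda>v::real^'n. of_vec v m)"
    by (cases "m < CARD('n)") (auto simp: of_vec_def intro!: continuous_intros)
qed

lemma nsphere_eq_top_of_set: "nsphere p = top_of_set (topspace (nsphere p))"
  unfolding nsphere by (simp add: euclidean_product_topology)

lemma continuous_map_to_vec:
  "continuous_map (nsphere (CARD('n::finite) - 1)) (top_of_set (sphere 0 1)) (to_vec :: _ \<Rightarrow> real^'n)"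
  by (subst nsphere_eq_top_of_set) (auto simp: continuous_on_to_vec to_vec_in_sphere)

lemma continuous_map_of_vec:
  "continuous_map (top_of_set (sphere 0 1)) (nsphere (CARD('n::finite) - 1)) (of_vec :: real^'n \<Rightarrow> _)"
  by (subst nsphere_eq_top_of_set) (auto simp: continuous_on_of_vec of_vec_in_nsphere simp del: One_nat_def)

text \<open>Normalising by \<open>sgn\<close> gives a degree to every continuous nowhere vanishing
  map of the sphere, so homotopies only have to avoid the origin.\<close>

definition sphere_degree :: "(real^'n::finite \<Rightarrow> real^'n) \<Rightarrow> int" where
  "sphere_degree f = Brouwer_degree2 (CARD('n) - 1) (of_vec \<circ> (sgn \<circ> f) \<circ> to_vec)"

lemma continuous_map_sgn:
  "continuous_map (top_of_set (-{0})) (top_of_set (sphere 0 1)) (sgn :: 'a::real_normed_vector \<Rightarrow> 'a)"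
  by (auto simp: norm_sgn sgn_div_norm intro!: continuous_intros)

lemma continuous_map_sphere_degree:
  fixes f :: "real^'n::finite \<Rightarrow> real^'n"
  assumes "continuous_map (top_of_set (sphere 0 1)) (top_of_set (-{0})) f"
  shows "continuous_map (nsphere (CARD('n) - 1)) (nsphere (CARD('n) - 1)) (of_vec \<circ> (sgn \<circ> f) \<circ> to_vec)"
  by (intro continuous_map_compose[OF continuous_map_to_vec] continuous_map_compose[OF _ continuous_map_of_vec]
       continuous_map_compose[OF assms] continuous_map_sgn)

lemma sphere_degree_homotopic:
  fixes f g :: "real^'n::finite \<Rightarrow> real^'n"
  assumes "homotopic_with_canon (\<lambda>_. True) (sphere 0 1) (-{0}) f g"
  shows "sphere_degree f = sphere_degree g"
proof -
  have "homotopic_with (\<lambda>_. True) (top_of_set (sphere 0 1)) (top_of_set (sphere 0 1)) (sgn \<circ> f) (sgn \<circ> g)"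
    using assms continuous_map_sgn by (rule homotopic_with_compose_continuous_map_left) simp
  then have "homotopic_with (\<lambda>_. True) (top_of_set (sphere 0 1)) (nsphere (CARD('n) - 1))
      (of_vec \<circ> (sgn \<circ> f)) (of_vec \<circ> (sgn \<circ> g))"
    using continuous_map_of_vec by (rule homotopic_with_compose_continuous_map_left) simp
  then have "homotopic_with (\<lambda>_. True) (nsphere (CARD('n) - 1)) (nsphere (CARD('n) - 1))
      (of_vec \<circ> (sgn \<circ> f) \<circ> to_vec) (of_vec \<circ> (sgn \<circ> g) \<circ> to_vec)"
    using continuous_map_to_vec by (rule homotopic_with_compose_continuous_map_right) simp
  then show ?thesis unfolding sphere_degree_def by (rule Brouwer_degree2_homotopic)
qed

lemma sphere_degree_cong:
  fixes f g :: "real^'n::finite \<Rightarrow> real^'n"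
  assumes "\<And>x. norm x = 1 \<Longrightarrow> f x = g x"
  shows "sphere_degree f = sphere_degree g"
  unfolding sphere_degree_def using assms by (intro Brouwer_degree2_eq) (simp add: to_vec_in_sphere)

lemma sphere_degree_linear_homotopy:
  fixes f g :: "real^'n::finite \<Rightarrow> real^'n"
  assumes "continuous_on (sphere 0 1) f" "continuous_on (sphere 0 1) g"
    and ne: "\<And>x t. norm x = 1 \<Longrightarrow> 0 \<le> t \<Longrightarrow> t \<le> 1 \<Longrightarrow> (1 - t) *\<^sub>R f x + t *\<^sub>R g x \<noteq> 0"
  shows "sphere_degree f = sphere_degree g"
  by (rule sphere_degree_homotopic, rule homotopic_with_linear)
    (use assms in \<open>force simp: closed_segment_def\<close>)+

text \<open>The hypothesis \<open>ne\<close> excludes opposite directions, the only way in which the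
  segment between two nonzero vectors can meet the origin. Most degrees below come from such a
  comparison with a map of known degree.\<close>

lemma sphere_degree_not_opposite:
  fixes f g :: "real^'n::finite \<Rightarrow> real^'n"
  assumes "continuous_on (sphere 0 1) f" "continuous_on (sphere 0 1) g"
    and "\<And>x. norm x = 1 \<Longrightarrow> f x \<noteq> 0" "\<And>x. norm x = 1 \<Longrightarrow> g x \<noteq> 0"
    and ne: "\<And>x c. norm x = 1 \<Longrightarrow> 0 < c \<Longrightarrow> f x + c *\<^sub>R g x \<noteq> 0"
  shows "sphere_degree f = sphere_degree g"
proof (rule sphere_degree_linear_homotopy)
  fix x :: "real^'n" and t :: real assume x: "norm x = 1" and t: "0 \<le> t" "t \<le> 1"
  show "(1 - t) *\<^sub>R f x + t *\<^sub>R g x \<noteq> 0"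
  proof (cases "t = 0 \<or> t = 1")
    case True then show ?thesis using assms x by auto
  next
    case False
    then have "(1 - t) *\<^sub>R f x + t *\<^sub>R g x = (1 - t) *\<^sub>R (f x + (t / (1 - t)) *\<^sub>R g x)"
      by (simp add: scaleR_add_right)
    moreover have "f x + (t / (1 - t)) *\<^sub>R g x \<noteq> 0" using False t x by (intro ne) auto
    ultimately show ?thesis using False by auto
  qed
qed (use assms in auto)

lemma sphere_degree_compose:
  fixes f g :: "real^'n::finite \<Rightarrow> real^'n"
  assumes f: "continuous_on (sphere 0 1) f" "\<And>x. norm x = 1 \<Longrightarrow> f x \<noteq> 0"
    and g: "continuous_on (sphere 0 1) g" "\<And>x. norm x = 1 \<Longrightarrow> norm (g x) = 1"
  shows "sphere_degree (f \<circ> g) = sphere_degree f * sphere_degree g"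
proof -
  have cf: "continuous_map (top_of_set (sphere 0 1)) (top_of_set (-{0})) f" using f by auto
  have cg: "continuous_map (top_of_set (sphere 0 1)) (top_of_set (-{0})) g" using g by force
  have "sphere_degree (f \<circ> g) = Brouwer_degree2 (CARD('n) - 1)
      ((of_vec \<circ> (sgn \<circ> f) \<circ> to_vec) \<circ> (of_vec \<circ> (sgn \<circ> g) \<circ> to_vec))"
    unfolding sphere_degree_def
    by (rule Brouwer_degree2_eq) (simp add: g to_vec_in_sphere sgn_div_norm)
  also have "\<dots> = sphere_degree f * sphere_degree g"
    unfolding sphere_degree_def
    by (rule Brouwer_degree2_compose[OF continuous_map_sphere_degree[OF cg] continuous_map_sphere_degree[OF cf]])
  finally show ?thesis .
qed

lemma sphere_degree_id: "sphere_degree (\<lambda>x::real^'n::finite. x) = 1"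
proof -
  have "sphere_degree (\<lambda>x::real^'n::finite. x) = Brouwer_degree2 (CARD('n) - 1) id"
    unfolding sphere_degree_def by (rule Brouwer_degree2_eq) (simp add: to_vec_in_sphere sgn_div_norm)
  then show ?thesis by simp
qed

text \<open>Both homomorphisms in \<open>ball_degree\<close> are carried to the sphere by the
  boundary operator, which is natural, and injective on the target because the whole space is
  contractible. On the sphere the comparison with the inclusion is multiplication by the Brouwer
  degree.\<close>

lemma ball_degree_eq_sphere_degree:
  fixes f :: "real^'n::finite \<Rightarrow> real^'n"
  assumes f: "continuous_on (cball 0 1) f" and y: "\<And>x. norm x = 1 \<Longrightarrow> f x \<noteq> y"
  shows "ball_degree f y = sphere_degree (\<lambda>x. f x - y)"
proof -
  let ?n = "int DIM(real^'n)"
  let ?p = "CARD('n) - 1"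
  let ?B = "top_of_set (cball (0::real^'n) 1)" and ?S = "sphere (0::real^'n) 1"
  let ?T = "- {0::real^'n}" and ?E = "euclidean :: (real^'n) topology"
  let ?HB = "relative_homology_group ?n ?B ?S" and ?HE = "relative_homology_group ?n ?E ?T"
  let ?rS = "reduced_homology_group (?n - 1) (top_of_set ?S)"
  let ?rT = "reduced_homology_group (?n - 1) (top_of_set ?T)"
  let ?N = "nsphere ?p" and ?rN = "reduced_homology_group (int ?p) (nsphere ?p)"
  let ?\<phi> = "\<lambda>x. f x - y" and ?d = "sphere_degree (\<lambda>x. f x - y)"
  let ?h = "of_vec \<circ> (sgn \<circ> ?\<phi>) \<circ> to_vec"
  have np: "?n - 1 = int ?p" using zero_less_card_finite[where 'a='n] by simp
  have sub: "subtopology ?B ?S = top_of_set ?S" by (simp add: subtopology_subtopology Int_absorb1)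
  have cE: "contractible_space ?E"
    by (metis contractible_space_top_of_set convex_imp_contractible convex_UNIV subtopology_UNIV)
  have ne: "?S \<noteq> {}" by simp
  have b2: "hom_boundary ?n ?E ?T \<in> iso ?HE ?rT"
    by (rule iso_relative_homology_of_contractible[OF cE]) (use ne in force)
  interpret HE: group ?HE by simp
  interpret rT: group ?rT by simp
  interpret rN: group ?rN by simp
  interpret bd: group_hom ?HE ?rT "hom_boundary ?n ?E ?T"
    using b2 by (simp add: group_hom_def group_hom_axioms_def iso_def)
  have c\<phi>: "continuous_map (top_of_set ?S) (top_of_set ?T) ?\<phi>"
    using y by (auto intro!: continuous_intros continuous_on_subset[OF f])
  have cid: "continuous_map (top_of_set ?S) (top_of_set ?T) id" by auto
  have ch: "continuous_map ?N ?N ?h" by (rule continuous_map_sphere_degree[OF c\<phi>])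
  have cg: "continuous_map ?N (top_of_set ?T) (to_vec :: _ \<Rightarrow> real^'n)"
    using continuous_map_compose[OF continuous_map_to_vec cid] by simp
  let ?j = "hom_induced (int ?p) ?N {} (top_of_set ?T) {} (to_vec :: _ \<Rightarrow> real^'n)"
  let ?k = "hom_induced (int ?p) (top_of_set ?S) {} ?N {} of_vec"
  interpret j: group_hom ?rN ?rT ?j
    by (simp add: group_hom_def group_hom_axioms_def np hom_induced_reduced_hom)
  \<comment> \<open>Normalising slides each vector along its own ray, so the homotopy stays in the
    punctured space.\<close>
  have sgnh: "homotopic_with (\<lambda>_. True) (top_of_set ?S) (top_of_set ?T) ?\<phi> (to_vec \<circ> (?h \<circ> of_vec))"
  proof -
    have "homotopic_with (\<lambda>_. True) (top_of_set ?S) (top_of_set ?T) ?\<phi> (sgn \<circ> ?\<phi>)"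
    proof (rule homotopic_with_linear)
      show "continuous_on ?S ?\<phi>" using c\<phi> by auto
      show "continuous_on ?S (sgn \<circ> ?\<phi>)"
        using continuous_map_compose[OF c\<phi> continuous_map_sgn] by auto
      fix x assume x: "x \<in> ?S"
      show "closed_segment (?\<phi> x) ((sgn \<circ> ?\<phi>) x) \<subseteq> ?T"
      proof -
        have "(1-u) *\<^sub>R ?\<phi> x + u *\<^sub>R sgn (?\<phi> x) \<noteq> 0" if u: "0 \<le> u" "u \<le> 1" for u
        proof -
          have nz: "?\<phi> x \<noteq> 0" using y x by auto
          have "(1-u) *\<^sub>R ?\<phi> x + u *\<^sub>R sgn (?\<phi> x) = ((1-u) + u / norm (?\<phi> x)) *\<^sub>R ?\<phi> x"
            unfolding sgn_div_norm scaleR_add_left by (simp add: divide_inverse)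
          moreover have "(1-u) + u / norm (?\<phi> x) > 0"
            using u nz by (cases "u = 0") (auto intro: add_nonneg_pos)
          ultimately show ?thesis using nz by simp
        qed
        then show ?thesis by (auto simp: closed_segment_def)
      qed
    qed
    then show ?thesis
      by (rule homotopic_with_eq) (auto simp: to_vec_in_sphere)
  qed
  have main: "hom_induced ?n ?B ?S ?E ?T ?\<phi> a = hom_induced ?n ?B ?S ?E ?T id a [^]\<^bsub>?HE\<^esub> ?d"
    if a: "a \<in> carrier ?HB" for a
  proof -
    define c where "c = hom_boundary ?n ?B ?S a"
    have c: "c \<in> carrier ?rS"
      using hom_in_carrier[OF hom_boundary_reduced_hom a] unfolding c_def sub .
    have kc: "?k c \<in> carrier ?rN"
      using hom_induced_reduced[of c "int ?p" "top_of_set ?S" ?N of_vec] c np by simp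
    have nat: "hom_boundary ?n ?E ?T (hom_induced ?n ?B ?S ?E ?T F a)
          = hom_induced (?n - 1) (top_of_set ?S) {} (top_of_set ?T) {} F c"
      if "continuous_on (cball 0 1) F" "F \<in> ?S \<rightarrow> ?T" for F
      using naturality_hom_induced[of ?B ?E F ?S ?T ?n] that unfolding sub c_def
      by (simp add: fun_eq_iff)
    have "hom_boundary ?n ?E ?T (hom_induced ?n ?B ?S ?E ?T ?\<phi> a)
        = hom_induced (int ?p) (top_of_set ?S) {} (top_of_set ?T) {} ?\<phi> c"
      unfolding np[symmetric] by (rule nat) (use y in \<open>auto intro!: continuous_intros f\<close>)
    also have "\<dots> = hom_induced (int ?p) (top_of_set ?S) {} (top_of_set ?T) {} (to_vec \<circ> (?h \<circ> of_vec)) c"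
      by (simp only: homology_homotopy_empty[OF sgnh])
    also have "\<dots> = ?j (hom_induced (int ?p) ?N {} ?N {} ?h (?k c))"
      using hom_induced_compose_empty[OF continuous_map_compose[OF continuous_map_of_vec ch] cg]
        hom_induced_compose_empty[OF continuous_map_of_vec ch] by (simp only: o_apply)
    also have "\<dots> = ?j (?k c [^]\<^bsub>?rN\<^esub> ?d)"
      by (simp only: Brouwer_degree2[OF kc] sphere_degree_def)
    also have "\<dots> = ?j (?k c) [^]\<^bsub>?rT\<^esub> ?d" by (rule j.hom_int_pow[OF kc])
    also have "?j (?k c) = hom_induced (int ?p) (top_of_set ?S) {} (top_of_set ?T) {} (to_vec \<circ> of_vec) c"
      using hom_induced_compose_empty[OF continuous_map_of_vec cg] by (simp only: o_apply)
    also have "hom_induced (int ?p) (top_of_set ?S) {} (top_of_set ?T) {} (to_vec \<circ> of_vec)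
        = hom_induced (int ?p) (top_of_set ?S) {} (top_of_set ?T) {} id"
      by (rule hom_induced_eq) simp
    also have "hom_induced (int ?p) (top_of_set ?S) {} (top_of_set ?T) {} id c
        = hom_boundary ?n ?E ?T (hom_induced ?n ?B ?S ?E ?T id a)"
      unfolding np[symmetric] by (rule nat[symmetric]) auto
    also have "\<dots> [^]\<^bsub>?rT\<^esub> ?d = hom_boundary ?n ?E ?T (hom_induced ?n ?B ?S ?E ?T id a [^]\<^bsub>?HE\<^esub> ?d)"
      by (rule bd.hom_int_pow[symmetric]) (rule hom_induced_carrier)
    finally have eq: "hom_boundary ?n ?E ?T (hom_induced ?n ?B ?S ?E ?T ?\<phi> a)
      = hom_boundary ?n ?E ?T (hom_induced ?n ?B ?S ?E ?T id a [^]\<^bsub>?HE\<^esub> ?d)" .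
    have "inj_on (hom_boundary ?n ?E ?T) (carrier ?HE)"
      using b2 unfolding iso_def bij_betw_def by blast
    from inj_onD[OF this eq hom_induced_carrier HE.int_pow_closed[OF hom_induced_carrier]]
    show ?thesis .
  qed
  have "y \<notin> f ` ?S" using y by (metis imageE dist_0_norm mem_sphere)
  then show ?thesis
    unfolding ball_degree_def
    using the1_equality[OF ball_degree_unique[of f y], of ?d] main by simp
qed

text \<open>An instance of \<open>Brouwer_degree2_double\<close>: \<open>A\<close> is the half turn
  of the plane, which squaring does not notice, and \<open>P\<close> squares one half plane and
  flattens the other onto the nonnegative \<open>j\<close>-axis.\<close>

lemma sphere_degree_double:
  fixes j k :: "'n::finite"
  assumes jk: "j \<noteq> k"
  shows "sphere_degree (\<lambda>x::real^'n. \<chi> i. if i = j then (x $ j)\<^sup>2 - (x $ k)\<^sup>2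
     else if i = k then 2 * x $ j * x $ k else x $ i) = 2"
proof -
  define G :: "real^'n \<Rightarrow> real^'n" where "G x = (\<chi> i. if i = j then (x $ j)\<^sup>2 - (x $ k)\<^sup>2
     else if i = k then 2 * x $ j * x $ k else x $ i)" for x
  define Q :: "real^'n \<Rightarrow> real^'n" where "Q x = (\<chi> i. if i = j then (x $ j)\<^sup>2 + (x $ k)\<^sup>2
     else if i = k then 0 else x $ i)" for x
  define P where "P x = (if x $ k \<ge> 0 then G x else Q x)" for x
  \<comment> \<open>The quarter turn is an intermediate map: \<open>P\<close> and \<open>A\<close>
    are opposite to the identity at \<open>- axis j 1\<close>, but neither is ever opposite to
    \<open>R\<close>, and \<open>R\<close> is never opposite to the identity.\<close>
  define R :: "real^'n \<Rightarrow> real^'n" where "R x = (\<chi> i. if i = j then - x $ k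
     else if i = k then x $ j else x $ i)" for x
  define A :: "real^'n \<Rightarrow> real^'n" where "A x = (\<chi> i. if i = j then - x $ j
     else if i = k then - x $ k else x $ i)" for x
  note defs = G_def Q_def R_def A_def
  have cif: "continuous_on S (\<lambda>x. \<chi> i. if i = j then f x else if i = k then g x else x $ i)"
    if "continuous_on S f" "continuous_on S g" for S and f g :: "real^'n \<Rightarrow> real"
  proof (rule continuous_on_vec_lambda)
    fix i show "continuous_on S (\<lambda>x. if i = j then f x else if i = k then g x else x $ i)"
      using that by (cases "i = j"; cases "i = k") (auto intro!: continuous_intros)
  qed
  have cGQ: "continuous_on S G" "continuous_on S Q" "continuous_on S R" "continuous_on S A" for S
    unfolding defs by (intro cif continuous_on_diff continuous_on_add continuous_on_power
      continuous_on_mult continuous_on_minus continuous_on_const continuous_on_component continuous_on_id)+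
  have cP: "continuous_on S P" for S
  proof -
    have "continuous_on ({x. x $ k \<ge> 0} \<union> {x. x $ k \<le> 0}) (\<lambda>x. if x $ k \<ge> 0 then G x else Q x)"
      by (rule continuous_on_cases[OF _ _ cGQ(1) cGQ(2)])
        (auto simp: defs vec_eq_iff intro!: closed_Collect_le continuous_intros)
    moreover have "S \<subseteq> {x. x $ k \<ge> 0} \<union> {x. x $ k \<le> 0}" by auto
    ultimately show ?thesis unfolding P_def by (rule continuous_on_subset)
  qed
  have nz: "x $ j \<noteq> 0 \<or> x $ k \<noteq> 0 \<or> (\<exists>i. i \<noteq> j \<and> i \<noteq> k \<and> x $ i \<noteq> 0)" if "norm x = 1" for x :: "real^'n"
    using that by (metis norm_zero vec_eq_iff zero_index zero_neq_one)
  have nzE: False if "norm x = 1" "\<And>i. i \<noteq> j \<Longrightarrow> i \<noteq> k \<Longrightarrow> x $ i = 0" "x $ j = 0" "x $ k = 0" for x :: "real^'n"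
    using nz[OF that(1)] that by auto
  have sq0: "(a::real)\<^sup>2 - b\<^sup>2 = 0 \<Longrightarrow> 2 * a * b = 0 \<Longrightarrow> a = 0 \<and> b = 0" for a b by auto
  have G0: "G x \<noteq> 0" if "norm x = 1" for x
  proof
    assume "G x = 0"
    then have *: "G x $ i = 0" for i by simp
    have o: "i \<noteq> j \<Longrightarrow> i \<noteq> k \<Longrightarrow> x $ i = 0" for i
      using *[of i] by (simp add: G_def)
    have "(x $ j)\<^sup>2 - (x $ k)\<^sup>2 = 0" "2 * x $ j * x $ k = 0"
      using *[of j] *[of k] jk by (simp_all add: G_def)
    then show False using sq0[of "x $ j" "x $ k"] nzE[OF that o] by blast
  qed
  have Q0: "Q x \<noteq> 0" if "norm x = 1" for x
  proof
    assume "Q x = 0"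
    then have *: "Q x $ i = 0" for i by simp
    have o: "i \<noteq> j \<Longrightarrow> i \<noteq> k \<Longrightarrow> x $ i = 0" for i
      using *[of i] by (simp add: Q_def)
    have "(x $ j)\<^sup>2 + (x $ k)\<^sup>2 = 0"
      using *[of j] jk by (simp add: Q_def)
    then show False using nzE[OF that o] by (auto simp: sum_power2_eq_zero_iff)
  qed
  have P0: "P x \<noteq> 0" if "norm x = 1" for x using G0 Q0 that by (simp add: P_def)
  have R0: "R x \<noteq> 0" if "norm x = 1" for x
  proof
    assume "R x = 0"
    then have *: "R x $ i = 0" for i by simp
    have o: "i \<noteq> j \<Longrightarrow> i \<noteq> k \<Longrightarrow> x $ i = 0" for i
      using *[of i] by (simp add: R_def)
    have "x $ k = 0" "x $ j = 0"
      using *[of j] *[of k] jk by (simp_all add: R_def)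
    then show False using nzE[OF that o] by blast
  qed
  have A0: "A x \<noteq> 0" and An: "norm (A x) = 1" if "norm x = 1" for x
  proof -
    have "(A x $ i)\<^sup>2 = (x $ i)\<^sup>2" for i by (simp add: A_def)
    then have "norm (A x) = norm x" by (simp add: norm_vec_def L2_set_def)
    then show "norm (A x) = 1" "A x \<noteq> 0" using that by auto
  qed
  \<comment> \<open>Coordinates outside the plane are kept by both maps and cannot cancel, so only
    the two coordinates of the plane remain to be examined.\<close>
  have opp: False if x: "norm x = 1" and c: "0 < c" and e: "F x + c *\<^sub>R F' x = 0"
      and F: "\<And>i. i \<noteq> j \<Longrightarrow> i \<noteq> k \<Longrightarrow> F x $ i = x $ i" "\<And>i. i \<noteq> j \<Longrightarrow> i \<noteq> k \<Longrightarrow> F' x $ i = x $ i"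
      and imp: "F x $ j + c * F' x $ j = 0 \<Longrightarrow> F x $ k + c * F' x $ k = 0 \<Longrightarrow> x $ j = 0 \<and> x $ k = 0"
    for F F' :: "real^'n \<Rightarrow> real^'n" and x c
  proof -
    have e': "F x $ i + c * F' x $ i = 0" for i using arg_cong[OF e, of "\<lambda>v. v $ i"] by simp
    have "x $ i = 0" if "i \<noteq> j" "i \<noteq> k" for i
    proof -
      have "(1 + c) * x $ i = 0" using e'[of i] F[OF that] by (simp add: algebra_simps)
      then show ?thesis using c by simp
    qed
    then show False using nzE[OF x] imp e' by blast
  qed
  have dR: "sphere_degree R = 1"
  proof -
    have "sphere_degree R = sphere_degree (\<lambda>x::real^'n. x)"
    proof (rule sphere_degree_not_opposite)
      fix x :: "real^'n" and c :: real assume x: "norm x = 1" and c: "0 < c"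
      show "R x + c *\<^sub>R x \<noteq> 0"
      proof
        assume e: "R x + c *\<^sub>R x = 0"
        show False
        proof (rule opp[where F=R and F'="\<lambda>x. x", OF x c e])
          assume "R x $ j + c * x $ j = 0" "R x $ k + c * x $ k = 0"
          then have 1: "x $ k = c * x $ j" and 2: "x $ j = - c * x $ k" using jk by (auto simp: R_def)
          have "x $ k = - (c * c) * x $ k" using 1 2 by simp
          then have "(1 + c * c) * x $ k = 0" by (simp add: algebra_simps)
          moreover have "1 + c * c > 0" using c by (simp add: add_pos_pos)
          ultimately show "x $ j = 0 \<and> x $ k = 0" using 2 by simp
        qed (auto simp: R_def)
      qed
    qed (auto simp: cGQ R0)
    then show ?thesis by (simp add: sphere_degree_id)
  qed
  have dA: "sphere_degree A = 1"
  proof -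
    have "sphere_degree A = sphere_degree R"
    proof (rule sphere_degree_not_opposite)
      fix x :: "real^'n" and c :: real assume x: "norm x = 1" and c: "0 < c"
      show "A x + c *\<^sub>R R x \<noteq> 0"
      proof
        assume e: "A x + c *\<^sub>R R x = 0"
        show False
        proof (rule opp[where F=A and F'=R, OF x c e])
          assume "A x $ j + c * R x $ j = 0" "A x $ k + c * R x $ k = 0"
          then have 1: "x $ j = - c * x $ k" and 2: "x $ k = c * x $ j" using jk by (auto simp: R_def A_def)
          have "x $ j = - (c * c) * x $ j" using 1 2 by simp
          then have "(1 + c * c) * x $ j = 0" by (simp add: algebra_simps)
          moreover have "1 + c * c > 0" using c by (simp add: add_pos_pos)
          ultimately show "x $ j = 0 \<and> x $ k = 0" using 2 by simp
        qed (auto simp: R_def A_def)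
      qed
    qed (auto simp: cGQ R0 A0)
    then show ?thesis by (simp add: dR)
  qed
  have dP: "sphere_degree P = 1"
  proof -
    have "sphere_degree P = sphere_degree R"
    proof (rule sphere_degree_not_opposite)
      fix x :: "real^'n" and c :: real assume x: "norm x = 1" and c: "0 < c"
      show "P x + c *\<^sub>R R x \<noteq> 0"
      proof
        assume e: "P x + c *\<^sub>R R x = 0"
        show False
        proof (rule opp[where F=P and F'=R, OF x c e])
          assume *: "P x $ j + c * R x $ j = 0" "P x $ k + c * R x $ k = 0"
          show "x $ j = 0 \<and> x $ k = 0"
          proof (cases "x $ k \<ge> 0")
            case True
            then have 1: "(x $ j)\<^sup>2 - (x $ k)\<^sup>2 = c * x $ k" and 2: "2 * x $ j * x $ k + c * x $ j = 0"
              using * jk by (auto simp: P_def G_def R_def)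
            have "x $ j * (2 * x $ k + c) = 0" using 2 by (simp add: algebra_simps)
            then have j0: "x $ j = 0" using True c by (auto simp: add_nonneg_pos)
            then have "x $ k * (x $ k + c) = 0" using 1 by (simp add: algebra_simps power2_eq_square)
            then show ?thesis using True c j0 by auto
          next
            case False
            then have 1: "(x $ j)\<^sup>2 + (x $ k)\<^sup>2 = c * x $ k" using * jk by (auto simp: P_def Q_def R_def)
            have "c * x $ k < 0" using False c by (simp add: mult_less_0_iff)
            then have "(x $ j)\<^sup>2 + (x $ k)\<^sup>2 < 0" using 1 by simp
            then show ?thesis using sum_power2_ge_zero[of "x $ j" "x $ k"] by linarith
          qed
        qed (auto simp: R_def P_def G_def Q_def)
      qed
    qed (auto simp: cGQ cP R0 P0)
    then show ?thesis by (simp add: dR)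
  qed
  have "sphere_degree G = 2 * sphere_degree P"
    unfolding sphere_degree_def
  proof (rule Brouwer_degree2_double[where j = "coord_index j" and k = "coord_index k" and A = "of_vec \<circ> (sgn \<circ> A) \<circ> to_vec"])
    show "coord_index j \<le> CARD('n) - 1" using coord_index_less[of j] by linarith
    show "Brouwer_degree2 (CARD('n) - 1) (of_vec \<circ> (sgn \<circ> A) \<circ> to_vec) = 1"
      using dA unfolding sphere_degree_def .
    fix x assume x: "x \<in> topspace (nsphere (CARD('n) - 1))"
    let ?x = "to_vec x :: real^'n"
    note nx = to_vec_in_sphere[OF x]
    have xi: "x (coord_index i) = ?x $ i" for i :: 'n by (simp add: to_vec_def)
    have sA: "sgn (A ?x) = A ?x" using An[OF nx] by (simp add: sgn_div_norm)
    show "(of_vec \<circ> (sgn \<circ> A) \<circ> to_vec) x (coord_index k) = - x (coord_index k)"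
      using jk by (simp add: sA xi) (simp add: A_def)
    have "G (A ?x) = G ?x" using jk by (simp add: G_def A_def vec_eq_iff)
    then show "(of_vec \<circ> (sgn \<circ> G) \<circ> to_vec) ((of_vec \<circ> (sgn \<circ> A) \<circ> to_vec) x)
        = (of_vec \<circ> (sgn \<circ> G) \<circ> to_vec) x" by (simp add: sA)
    show "(of_vec \<circ> (sgn \<circ> P) \<circ> to_vec) x = (of_vec \<circ> (sgn \<circ> G) \<circ> to_vec) x"
      if "x (coord_index k) \<ge> 0" using that unfolding xi by (simp add: P_def)
    show "(of_vec \<circ> (sgn \<circ> P) \<circ> to_vec) x (coord_index j) \<ge> 0" if "x (coord_index k) \<le> 0"
    proof -
      have "P ?x $ j \<ge> 0" using that unfolding xi by (auto simp: P_def G_def Q_def)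
      then show ?thesis by (simp add: sgn_div_norm)
    qed
  qed (intro continuous_map_sphere_degree; use G0 P0 A0 in \<open>auto simp: cGQ cP\<close>)+
  then show ?thesis using dP by (simp add: G_def[abs_def])
qed

section \<open>The pillow and its folding maps\<close>

lemma infnorm_le_iff: "infnorm (x::real^'n::finite) \<le> c \<longleftrightarrow> (\<forall>i. \<bar>x $ i\<bar> \<le> c)"
proof
  assume "infnorm x \<le> c" then show "\<forall>i. \<bar>x $ i\<bar> \<le> c"
    using component_le_infnorm_cart order_trans by blast
next
  assume "\<forall>i. \<bar>x $ i\<bar> \<le> c" then show "infnorm x \<le> c"
    unfolding infnorm_cart by (intro cSup_least) auto
qed

lemma infnorm_attained: obtains i where "infnorm (x::real^'n::finite) = \<bar>x $ i\<bar>"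
proof -
  have eq: "{\<bar>x $ i\<bar> |i. i \<in> UNIV} = range (\<lambda>i. \<bar>x $ i\<bar>)" by auto
  have "infnorm x = Max (range (\<lambda>i. \<bar>x $ i\<bar>))"
    unfolding infnorm_cart eq by (rule cSup_eq_Max) auto
  moreover have "Max (range (\<lambda>i. \<bar>x $ i\<bar>)) \<in> range (\<lambda>i. \<bar>x $ i\<bar>)" by (rule Max_in) auto
  ultimately obtain i where "infnorm x = \<bar>x $ i\<bar>" by (metis (no_types, lifting) imageE)
  then show ?thesis by (rule that)
qed

lemma component_diff_le_infnorm: "\<bar>x $ i - y $ i\<bar> \<le> infnorm (x - y :: real^'n::finite)"
  using component_le_infnorm_cart[of "x - y" i] by simp

lemma continuous_on_infnorm_lipschitz:
  fixes f :: "real^'n::finite \<Rightarrow> real^'m::finite"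
  assumes "\<And>x y. x \<in> S \<Longrightarrow> y \<in> S \<Longrightarrow> infnorm (f x - f y) \<le> L * infnorm (x - y)"
  shows "continuous_on S f"
proof -
  have "(sqrt DIM(real^'m) * max 0 L)-lipschitz_on S f"
  proof (rule lipschitz_onI)
    fix x y assume xy: "x \<in> S" "y \<in> S"
    have "norm (f x - f y) \<le> sqrt DIM(real^'m) * infnorm (f x - f y)" by (rule norm_le_infnorm)
    also have "\<dots> \<le> sqrt DIM(real^'m) * (max 0 L * norm (x - y))"
    proof (rule mult_left_mono)
      have "infnorm (f x - f y) \<le> L * infnorm (x - y)" using assms xy by blast
      also have "\<dots> \<le> max 0 L * infnorm (x - y)" by (intro mult_right_mono infnorm_pos_le) simp
      also have "\<dots> \<le> max 0 L * norm (x - y)" by (intro mult_left_mono infnorm_le_norm) simp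
      finally show "infnorm (f x - f y) \<le> max 0 L * norm (x - y)" .
    qed simp
    finally show "dist (f x) (f y) \<le> sqrt DIM(real^'m) * max 0 L * dist x y"
      by (simp add: dist_norm mult.assoc)
  qed simp
  then show ?thesis by (rule lipschitz_on_continuous_on)
qed

definition flat :: "'n \<Rightarrow> real^'n::finite \<Rightarrow> real^'n" where
  "flat z x = (\<chi> i. if i = z then 0 else x $ i)"

text \<open>Its unit sphere is a bipyramid: over each point of the cube it has the two heights whose
  modulus is the sup-norm distance of that point from the boundary of the cube.\<close>

definition pillow_norm :: "'n \<Rightarrow> real^'n::finite \<Rightarrow> real" where
  "pillow_norm z x = infnorm (flat z x) + \<bar>x $ z\<bar>"

lemma flat_diff: "flat z x - flat z y = flat z (x - y)"
  and flat_scaleR: "flat z (c *\<^sub>R x) = c *\<^sub>R flat z x"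
  by (simp_all add: flat_def vec_eq_iff)

lemma infnorm_flat_le_iff: "0 \<le> c \<Longrightarrow> infnorm (flat z x) \<le> c \<longleftrightarrow> (\<forall>i. i \<noteq> z \<longrightarrow> \<bar>x $ i\<bar> \<le> c)"
  by (auto simp: infnorm_le_iff flat_def)

lemma component_le_infnorm_flat: "i \<noteq> z \<Longrightarrow> \<bar>x $ i\<bar> \<le> infnorm (flat z x)"
  using component_le_infnorm_cart[of "flat z x" i] by (simp add: flat_def)

lemma infnorm_flat_le: "infnorm (flat z x) \<le> infnorm x"
  using component_le_infnorm_cart[of x] infnorm_flat_le_iff[OF infnorm_pos_le] by blast

lemma infnorm_flat_attained:
  assumes "infnorm (flat z x) > 0"
  obtains j where "j \<noteq> z" "infnorm (flat z x) = \<bar>x $ j\<bar>"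
proof -
  obtain j where j: "infnorm (flat z x) = \<bar>flat z x $ j\<bar>" by (rule infnorm_attained)
  then have "j \<noteq> z" using assms by (auto simp: flat_def)
  then show ?thesis using j that by (simp add: flat_def)
qed

lemma infnorm_flat_cong: "(\<And>i. i \<noteq> z \<Longrightarrow> x $ i = y $ i) \<Longrightarrow> infnorm (flat z x) = infnorm (flat z y)"
  by (rule arg_cong[where f = infnorm]) (auto simp: flat_def vec_eq_iff)

lemma infnorm_flat_diff: "\<bar>infnorm (flat z x) - infnorm (flat z y)\<bar> \<le> infnorm (flat z (x - y))"
  using absdiff_infnorm[of "flat z x" "flat z y"] by (simp add: flat_diff)

lemma pillow_norm_scaleR: "pillow_norm z (c *\<^sub>R x) = \<bar>c\<bar> * pillow_norm z x"
  by (simp add: pillow_norm_def flat_scaleR infnorm_mul abs_mult distrib_left)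

lemma pillow_norm_pos: "x \<noteq> 0 \<Longrightarrow> pillow_norm z x > 0"
proof -
  assume "x \<noteq> 0"
  then obtain i where i: "x $ i \<noteq> 0" by (auto simp: vec_eq_iff)
  show ?thesis
    using i component_le_infnorm_flat[of i z x] infnorm_pos_le[of "flat z x"]
    by (cases "i = z") (auto simp: pillow_norm_def)
qed

lemma pillow_norm_0 [simp]: "pillow_norm z 0 = 0"
  using pillow_norm_scaleR[of z 0 0] by simp

lemma continuous_on_pillow_norm: "continuous_on S (pillow_norm z)"
proof -
  have "continuous_on S (\<lambda>x. flat z x)"
    unfolding flat_def
  proof (rule continuous_on_vec_lambda)
    fix i show "continuous_on S (\<lambda>x. if i = z then 0 else x $ i)"
      by (cases "i = z") (auto intro!: continuous_intros)
  qed
  then show ?thesis unfolding pillow_norm_def by (intro continuous_intros)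
qed

section \<open>Degrees of self-maps of the pillow\<close>

definition pillow :: "'n \<Rightarrow> (real^'n::finite) set" where
  "pillow z = {x. pillow_norm z x = 1}"

definition to_pillow :: "'n \<Rightarrow> real^'n::finite \<Rightarrow> real^'n" where
  "to_pillow z x = x /\<^sub>R pillow_norm z x"

lemma to_pillow_in: "x \<noteq> 0 \<Longrightarrow> to_pillow z x \<in> pillow z"
  using pillow_norm_pos[of x z] by (simp add: to_pillow_def pillow_def pillow_norm_scaleR)

lemma pillow_nonzero: "x \<in> pillow z \<Longrightarrow> x \<noteq> 0"
  by (auto simp: pillow_def)

lemma to_pillow_sgn: "x \<in> pillow z \<Longrightarrow> to_pillow z (sgn x) = x"
  using pillow_nonzero[of x z] by (simp add: to_pillow_def pillow_def sgn_div_norm pillow_norm_scaleR)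

lemma continuous_on_to_pillow: "continuous_on (sphere 0 1) (to_pillow z)"
proof -
  have "pillow_norm z x \<noteq> 0" if "x \<in> sphere 0 1" for x
    using pillow_norm_pos[of x z] that by force
  then show ?thesis unfolding to_pillow_def
    by (intro continuous_intros continuous_on_pillow_norm) auto
qed

lemma to_pillow_image: "to_pillow z ` sphere 0 1 \<subseteq> pillow z"
proof -
  have "to_pillow z x \<in> pillow z" if "norm x = 1" for x
    using that by (intro to_pillow_in) auto
  then show ?thesis by auto
qed

lemma pillow_infnorm_le_1: "x \<in> pillow z \<Longrightarrow> infnorm x \<le> 1"
proof -
  assume x: "x \<in> pillow z"
  have "\<bar>x $ i\<bar> \<le> 1" for i
    using x component_le_infnorm_flat[of i z x] infnorm_pos_le[of "flat z x"]
    by (cases "i = z") (auto simp: pillow_def pillow_norm_def)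
  then show ?thesis by (simp add: infnorm_le_iff)
qed

definition pillow_degree :: "'n \<Rightarrow> (real^'n::finite \<Rightarrow> real^'n) \<Rightarrow> int" where
  "pillow_degree z f = sphere_degree (f \<circ> to_pillow z)"

text \<open>On the pillow \<open>to_pillow z\<close> undoes \<open>sgn\<close>, so
  \<open>f \<circ> g\<close> factors through the round sphere, where degrees multiply.\<close>

lemma sphere_degree_pillow_compose:
  fixes z :: "'a::finite"
  assumes f: "continuous_on (pillow z) f" "f \<in> pillow z \<rightarrow> pillow z"
    and g: "continuous_on (sphere 0 1) g" "g \<in> sphere 0 1 \<rightarrow> pillow z"
  shows "sphere_degree (f \<circ> g) = pillow_degree z f * sphere_degree g"
proof -
  have gp: "g x \<in> pillow z" if "norm x = 1" for x using g(2) that by auto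
  have tp: "to_pillow z x \<in> pillow z" if "norm x = 1" for x
    using to_pillow_in[of x z] that by force
  have "sphere_degree (f \<circ> g) = sphere_degree ((f \<circ> to_pillow z) \<circ> (sgn \<circ> g))"
    by (rule sphere_degree_cong) (simp add: to_pillow_sgn gp)
  also have "\<dots> = sphere_degree (f \<circ> to_pillow z) * sphere_degree (sgn \<circ> g)"
  proof (rule sphere_degree_compose)
    show "continuous_on (sphere 0 1) (f \<circ> to_pillow z)"
      by (rule continuous_on_compose[OF continuous_on_to_pillow continuous_on_subset[OF f(1) to_pillow_image]])
    show "(f \<circ> to_pillow z) x \<noteq> 0" if "norm x = 1" for x
      using f(2) tp[OF that] pillow_nonzero[of "f (to_pillow z x)" z] by auto
    show "continuous_on (sphere 0 1) (sgn \<circ> g)"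
      unfolding o_def sgn_div_norm using gp pillow_nonzero by (intro continuous_intros g) force
    show "norm ((sgn \<circ> g) x) = 1" if "norm x = 1" for x
      using gp[OF that] pillow_nonzero by (auto simp: norm_sgn)
  qed
  also have "sphere_degree (sgn \<circ> g) = sphere_degree g"
  proof -
    have "sgn (sgn v) = sgn v" for v :: "real^'a" by (cases "v = 0") (auto simp: sgn_div_norm)
    then show ?thesis by (simp add: sphere_degree_def o_def)
  qed
  finally show ?thesis unfolding pillow_degree_def .
qed

lemma pillow_degree_compose:
  assumes "continuous_on (pillow z) f" "f \<in> pillow z \<rightarrow> pillow z"
    and "continuous_on (pillow z) g" "g \<in> pillow z \<rightarrow> pillow z"
  shows "pillow_degree z (f \<circ> g) = pillow_degree z f * pillow_degree z g"
proof -
  have "sphere_degree (f \<circ> (g \<circ> to_pillow z)) = pillow_degree z f * sphere_degree (g \<circ> to_pillow z)"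
  proof (rule sphere_degree_pillow_compose)
    show "continuous_on (sphere 0 1) (g \<circ> to_pillow z)"
      by (rule continuous_on_compose[OF continuous_on_to_pillow continuous_on_subset[OF assms(3) to_pillow_image]])
    show "g \<circ> to_pillow z \<in> sphere 0 1 \<rightarrow> pillow z" using assms(4) to_pillow_image[of z] by fastforce
  qed (use assms in auto)
  then show ?thesis by (simp add: pillow_degree_def comp_assoc)
qed

lemma pillow_degree_id: "pillow_degree (z::'n::finite) (\<lambda>x. x) = 1"
proof -
  have "sphere_degree ((\<lambda>x. x) \<circ> to_pillow z) = sphere_degree (\<lambda>x::real^'n. x)"
  proof (rule sphere_degree_not_opposite)
    fix x :: "real^'n" and c :: real assume x: "norm x = 1" and c: "0 < c"
    have "pillow_norm z x > 0" using x by (intro pillow_norm_pos) auto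
    then have "inverse (pillow_norm z x) + c > 0" using c by (simp add: add_pos_pos)
    moreover have "((\<lambda>x. x) \<circ> to_pillow z) x + c *\<^sub>R x = (inverse (pillow_norm z x) + c) *\<^sub>R x"
      by (simp add: to_pillow_def scaleR_add_left)
    ultimately show "((\<lambda>x. x) \<circ> to_pillow z) x + c *\<^sub>R x \<noteq> 0" using x by force
  next
    fix x :: "real^'n" assume "norm x = 1"
    then have "x \<noteq> 0" by auto
    then show "((\<lambda>x. x) \<circ> to_pillow z) x \<noteq> 0"
      using pillow_nonzero[OF to_pillow_in] by simp
  qed (auto simp: continuous_on_to_pillow[unfolded o_def] o_def)
  then show ?thesis by (simp add: pillow_degree_def sphere_degree_id)
qed

lemma pillow_degree_funpow:
  assumes "continuous_on (pillow z) f" "f \<in> pillow z \<rightarrow> pillow z"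
  shows "continuous_on (pillow z) (f ^^ m) \<and> (f ^^ m) \<in> pillow z \<rightarrow> pillow z \<and> pillow_degree z (f ^^ m) = pillow_degree z f ^ m"
proof (induction m)
  case 0 show ?case by (auto simp: id_def pillow_degree_id)
next
  case (Suc m)
  have "continuous_on (pillow z) (f \<circ> (f ^^ m))"
    using Suc assms by (intro continuous_on_compose) (auto elim!: continuous_on_subset)
  then show ?case using Suc assms by (auto simp: pillow_degree_compose simp del: o_apply) (auto simp: Pi_iff)
qed

text \<open>The pillow is the double of the cube with coordinates \<open>i \<noteq> z\<close>, its two sides being told apart by
  the sign of the \<open>z\<close>-coordinate. The map folds the cube in two along the directions in \<open>J\<close>;
  the signs send adjacent pieces to opposite sides, so that no orientation is reversed.\<close>

definition fold_cube :: "'n set \<Rightarrow> real^'n::finite \<Rightarrow> real^'n" where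
  "fold_cube J x = (\<chi> i. if i \<in> J then 2 * \<bar>x $ i\<bar> - 1 else x $ i)"

text \<open>The pillow dictates the modulus of the \<open>z\<close>-coordinate and leaves only its
  sign free. At points of the pillow where a factor \<open>sgn\<close> is 0, this modulus is 0 as
  well, by \<open>fold_cube_defect\<close>.\<close>

definition pillow_fold :: "'n \<Rightarrow> 'n set \<Rightarrow> real^'n::finite \<Rightarrow> real^'n" where
  "pillow_fold z J x = (\<chi> i. if i = z then sgn (x $ z) * (\<Prod>j\<in>J. sgn (x $ j)) * (1 - infnorm (flat z (fold_cube J x)))
     else fold_cube J x $ i)"

lemma flat_pillow_fold: "flat z (pillow_fold z J x) = flat z (fold_cube J x)"
  by (simp add: flat_def pillow_fold_def vec_eq_iff)

lemma fold_cube_flat_le_1: "x \<in> pillow z \<Longrightarrow> infnorm (flat z (fold_cube J x)) \<le> 1"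
proof -
  assume x: "x \<in> pillow z"
  have "\<bar>x $ i\<bar> \<le> 1" for i using pillow_infnorm_le_1[OF x] by (auto simp: infnorm_le_iff)
  then have "\<bar>fold_cube J x $ i\<bar> \<le> 1" for i
    by (auto simp: fold_cube_def abs_le_iff)
  then show ?thesis by (simp add: infnorm_flat_le_iff)
qed

text \<open>The left side is the height of the image. Near a crease \<open>x $ i = 0\<close> the
  folded coordinate is close to -1; near \<open>x $ z = 0\<close> some coordinate has modulus close
  to 1 and keeps this under folding. So the sign factors of \<open>pillow_fold\<close> jump only
  where the height vanishes, and at a rate that fits the Lipschitz constant 2.\<close>

lemma fold_cube_defect:
  assumes x: "x \<in> pillow z" and i: "i = z \<or> i \<in> J" and z: "z \<notin> J"
  shows "1 - infnorm (flat z (fold_cube J x)) \<le> 2 * \<bar>x $ i\<bar>"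
proof (cases "i = z")
  case True
  have xz: "\<bar>x $ z\<bar> = 1 - infnorm (flat z x)" using x by (simp add: pillow_def pillow_norm_def)
  show ?thesis
  proof (cases "infnorm (flat z x) > 0")
    case False
    then have "\<bar>x $ z\<bar> \<ge> 1" using xz by linarith
    then show ?thesis using infnorm_pos_le[of "flat z (fold_cube J x)"] unfolding True by linarith
  next
    case pos: True
    obtain j where j: "j \<noteq> z" "infnorm (flat z x) = \<bar>x $ j\<bar>" using infnorm_flat_attained[OF pos] by blast
    have "infnorm (flat z x) \<le> 1" using xz by linarith
    have "\<bar>fold_cube J x $ j\<bar> \<le> infnorm (flat z (fold_cube J x))" using component_le_infnorm_flat j by blast
    moreover have "\<bar>fold_cube J x $ j\<bar> \<ge> 2 * \<bar>x $ j\<bar> - 1" using j xz by (auto simp: fold_cube_def)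
    ultimately show ?thesis using xz j unfolding True by linarith
  qed
next
  case False
  then have iJ: "i \<in> J" "i \<noteq> z" using i by auto
  have "\<bar>fold_cube J x $ i\<bar> \<ge> 1 - 2 * \<bar>x $ i\<bar>" using iJ by (simp add: fold_cube_def)
  then show ?thesis using component_le_infnorm_flat[OF iJ(2), of "fold_cube J x"] by linarith
qed

lemma sgn_prod_sgn: "sgn (\<Prod>j\<in>J. sgn (f j :: real)) = (\<Prod>j\<in>J. sgn (f j))"
  by (induction J rule: infinite_finite_induct) (simp_all add: sgn_mult sgn_sgn)

lemma abs_sgn_mult_le_1: "\<bar>sgn (a::real) * (\<Prod>j\<in>J. sgn (f j))\<bar> \<le> 1"
proof -
  have "\<bar>\<Prod>j\<in>J. sgn (f j)\<bar> \<le> 1" using abs_sgn_eq[of "\<Prod>j\<in>J. sgn (f j)"] unfolding sgn_prod_sgn by simp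
  then show ?thesis by (simp add: abs_mult abs_sgn_eq)
qed

lemma pillow_fold_in:
  assumes x: "x \<in> pillow z" and z: "z \<notin> J"
  shows "pillow_fold z J x \<in> pillow z"
proof -
  let ?m = "1 - infnorm (flat z (fold_cube J x))" and ?s = "sgn (x $ z) * (\<Prod>j\<in>J. sgn (x $ j))"
  have m: "?m \<ge> 0" using fold_cube_flat_le_1[OF x, of J] by simp
  have "\<bar>?s * ?m\<bar> = ?m"
  proof (cases "?s = 0")
    case True
    then obtain i where i: "i = z \<or> i \<in> J" "x $ i = 0" by (auto simp: sgn_zero_iff)
    then have "?m \<le> 0" using fold_cube_defect[OF x i(1) z] by simp
    then show ?thesis using m by simp
  next
    case False
    then have "\<bar>?s\<bar> = 1"
      using abs_sgn_eq[of ?s] unfolding sgn_mult sgn_prod_sgn sgn_sgn by (simp split: if_splits)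
    then show ?thesis using m by (simp add: abs_mult)
  qed
  moreover have "pillow_fold z J x $ z = ?s * ?m" by (simp add: pillow_fold_def)
  ultimately show ?thesis by (simp add: pillow_def pillow_norm_def flat_pillow_fold)
qed

lemma pillow_fold_lipschitz:
  assumes x: "x \<in> pillow z" and x': "x' \<in> pillow z" and z: "z \<notin> J"
  shows "infnorm (pillow_fold z J x - pillow_fold z J x') \<le> 2 * infnorm (x - x')"
proof -
  let ?d = "infnorm (x - x')"
  have fc: "\<bar>fold_cube J x $ i - fold_cube J x' $ i\<bar> \<le> 2 * ?d" for i
    using component_diff_le_infnorm[of x i x'] infnorm_pos_le[of "x - x'"] by (auto simp: fold_cube_def)
  define m where "m = 1 - infnorm (flat z (fold_cube J x))"
  define m' where "m' = 1 - infnorm (flat z (fold_cube J x'))"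
  have m0: "m \<ge> 0" "m' \<ge> 0" using fold_cube_flat_le_1[OF x, of J] fold_cube_flat_le_1[OF x', of J] by (auto simp: m_def m'_def)
  have "\<bar>m - m'\<bar> \<le> infnorm (flat z (fold_cube J x - fold_cube J x'))"
    using infnorm_flat_diff[of z "fold_cube J x" "fold_cube J x'"] by (simp add: m_def m'_def)
  also have "\<dots> \<le> 2 * ?d" using fc infnorm_pos_le[of "x - x'"] by (subst infnorm_flat_le_iff) auto
  finally have mm: "\<bar>m - m'\<bar> \<le> 2 * ?d" .
  define s where "s = sgn (x $ z) * (\<Prod>j\<in>J. sgn (x $ j))"
  define s' where "s' = sgn (x' $ z) * (\<Prod>j\<in>J. sgn (x' $ j))"
  have s1: "\<bar>s\<bar> \<le> 1" "\<bar>s'\<bar> \<le> 1"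
    unfolding s_def s'_def by (rule abs_sgn_mult_le_1)+
  have "\<bar>s * m - s' * m'\<bar> \<le> 2 * ?d"
  proof (cases "\<forall>i. i = z \<or> i \<in> J \<longrightarrow> sgn (x $ i) = sgn (x' $ i)")
    case True
    then have "s = s'" by (auto simp: s_def s'_def intro!: prod.cong)
    then have "\<bar>s * m - s' * m'\<bar> = \<bar>s\<bar> * \<bar>m - m'\<bar>" by (simp add: abs_mult flip: right_diff_distrib)
    also have "\<dots> \<le> 1 * \<bar>m - m'\<bar>" using s1 by (intro mult_right_mono) auto
    finally show ?thesis using mm by simp
  next
    case False
    \<comment> \<open>The signs of \<open>x $ i\<close> and \<open>x' $ i\<close> differ, so their
      moduli add up to their distance; by \<open>fold_cube_defect\<close> they control both
      heights.\<close>
    then obtain i where i: "i = z \<or> i \<in> J" and ne: "sgn (x $ i) \<noteq> sgn (x' $ i)" by auto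
    have "\<bar>s * m - s' * m'\<bar> \<le> \<bar>s\<bar> * m + \<bar>s'\<bar> * m'"
      using abs_triangle_ineq4[of "s * m" "s' * m'"] m0 by (simp add: abs_mult)
    also have "\<dots> \<le> 1 * m + 1 * m'" using s1 m0 by (intro add_mono mult_right_mono) auto
    also have "\<dots> \<le> 2 * (\<bar>x $ i\<bar> + \<bar>x' $ i\<bar>)"
      using fold_cube_defect[OF x i z] fold_cube_defect[OF x' i z] by (simp add: m_def m'_def)
    also have "\<bar>x $ i\<bar> + \<bar>x' $ i\<bar> = \<bar>x $ i - x' $ i\<bar>" using ne by (auto simp: sgn_if split: if_splits)
    also have "\<dots> \<le> ?d" by (rule component_diff_le_infnorm)
    finally show ?thesis by simp
  qed
  moreover have "pillow_fold z J x $ z = s * m" "pillow_fold z J x' $ z = s' * m'"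
    by (simp_all add: pillow_fold_def s_def s'_def m_def m'_def)
  ultimately have "\<bar>pillow_fold z J x $ i - pillow_fold z J x' $ i\<bar> \<le> 2 * ?d" for i
    using fc[of i] by (cases "i = z") (auto simp: pillow_fold_def)
  then show ?thesis by (simp add: infnorm_le_iff)
qed

lemma continuous_on_pillow_fold: "z \<notin> J \<Longrightarrow> continuous_on (pillow z) (pillow_fold z J)"
  by (rule continuous_on_infnorm_lipschitz) (rule pillow_fold_lipschitz)

text \<open>This lets the degree be computed one direction at a time. The sign of the
  \<open>z\<close>-coordinate survives the inner fold unless the height becomes 0, and then the
  height after the outer fold is 0 too.\<close>

lemma pillow_fold_insert:
  assumes x: "x \<in> pillow z" and z: "z \<notin> insert i J" and i: "i \<notin> J"
  shows "pillow_fold z {i} (pillow_fold z J x) = pillow_fold z (insert i J) x"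
proof -
  have iz: "i \<noteq> z" using z by auto
  let ?y = "pillow_fold z J x"
  have fc: "fold_cube {i} ?y $ l = fold_cube (insert i J) x $ l" if "l \<noteq> z" for l
    using that i by (simp add: fold_cube_def pillow_fold_def)
  have m: "infnorm (flat z (fold_cube {i} ?y)) = infnorm (flat z (fold_cube (insert i J) x))"
    by (rule infnorm_flat_cong) (rule fc)
  let ?m = "1 - infnorm (flat z (fold_cube J x))"
  have y: "?y \<in> pillow z" using pillow_fold_in[OF x] z by simp
  have yz: "?y $ z = sgn (x $ z) * (\<Prod>j\<in>J. sgn (x $ j)) * ?m" by (simp add: pillow_fold_def)
  have yi: "?y $ i = x $ i" using iz i by (simp add: pillow_fold_def fold_cube_def)
  have ss: "sgn (?y $ z) = sgn (x $ z) * (\<Prod>j\<in>J. sgn (x $ j)) * sgn ?m"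
    unfolding yz by (simp add: sgn_mult sgn_prod_sgn sgn_sgn)
  have "pillow_fold z {i} ?y $ l = pillow_fold z (insert i J) x $ l" for l
  proof (cases "l = z")
    case False then show ?thesis using fc[OF False] by (simp add: pillow_fold_def)
  next
    case True
    have "sgn (?y $ z) * sgn (x $ i) * (1 - infnorm (flat z (fold_cube {i} ?y)))
       = sgn (x $ z) * (\<Prod>j\<in>insert i J. sgn (x $ j)) * (1 - infnorm (flat z (fold_cube {i} ?y)))"
    proof (cases "?m = 0")
      case m0: True
      then have "?y $ z = 0" using yz by simp
      then have "1 - infnorm (flat z (fold_cube {i} ?y)) \<le> 0"
        using fold_cube_defect[OF y, of z "{i}"] iz by auto
      then have "1 - infnorm (flat z (fold_cube {i} ?y)) = 0"
        using fold_cube_flat_le_1[OF y, of "{i}"] by simp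
      then show ?thesis by (simp only: mult_zero_right)
    next
      case False
      then have "sgn ?m = 1" using fold_cube_flat_le_1[OF x, of J] by simp
      then show ?thesis unfolding ss using i by simp
    qed
    then show ?thesis using True m yi by (simp add: pillow_fold_def)
  qed
  then show ?thesis by (simp add: vec_eq_iff)
qed

text \<open>Up to homotopy a single fold is squaring in the plane of \<open>i\<close> and
  \<open>z\<close>. If the two were opposite, the remaining coordinates would vanish. The
  \<open>z\<close>-coordinates never have opposite signs and that of \<open>D\<close> is 0 only on
  the two axes, where the \<open>i\<close>-coordinates have the same sign.\<close>

lemma pillow_degree_fold_singleton:
  fixes z i :: "'n::finite"
  assumes iz: "i \<noteq> z"
  shows "pillow_degree z (pillow_fold z {i}) = 2"
proof -
  define D :: "real^'n \<Rightarrow> real^'n" where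
    "D x = (\<chi> l. if l = i then (x $ i)\<^sup>2 - (x $ z)\<^sup>2 else if l = z then 2 * x $ i * x $ z else x $ l)" for x
  let ?F = "pillow_fold z {i} \<circ> to_pillow z"
  have "sphere_degree ?F = sphere_degree D"
  proof (rule sphere_degree_not_opposite)
    show "continuous_on (sphere 0 1) ?F"
      by (rule continuous_on_compose[OF continuous_on_to_pillow
            continuous_on_subset[OF continuous_on_pillow_fold to_pillow_image]]) (use iz in simp)
    show "continuous_on (sphere 0 1) D"
      unfolding D_def
    proof (rule continuous_on_vec_lambda)
      fix l
      show "continuous_on (sphere 0 1) (\<lambda>x::real^'n. if l = i then (x $ i)\<^sup>2 - (x $ z)\<^sup>2 else if l = z then 2 * x $ i * x $ z else x $ l)"
        by (cases "l = i"; cases "l = z") (auto intro!: continuous_intros)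
    qed
  next
    fix x :: "real^'n" assume x: "norm x = 1"
    then have x0: "x \<noteq> 0" by auto
    have w: "to_pillow z x \<in> pillow z" using x0 by (rule to_pillow_in)
    have *: "pillow_fold z {i} (to_pillow z x) \<in> pillow z" using iz by (intro pillow_fold_in[OF w]) auto
    show "?F x \<noteq> 0" using pillow_nonzero[OF *] by simp
    show "D x \<noteq> 0"
    proof
      assume "D x = 0"
      then have d: "D x $ l = 0" for l by simp
      have "(x $ i)\<^sup>2 - (x $ z)\<^sup>2 = 0" "x $ i = 0 \<or> x $ z = 0" using d[of i] d[of z] iz by (auto simp: D_def)
      then have "x $ i = 0 \<and> x $ z = 0" by auto
      moreover have "x $ l = 0" if "l \<noteq> i" "l \<noteq> z" for l using d[of l] that by (simp add: D_def)
      ultimately have "x $ l = 0" for l by (cases "l = i"; cases "l = z") auto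
      then show False using x0 by (simp add: vec_eq_iff)
    qed
    fix c :: real assume c: "0 < c"
    show "?F x + c *\<^sub>R D x \<noteq> 0"
    proof
      assume e: "?F x + c *\<^sub>R D x = 0"
      have e': "?F x $ l + c * D x $ l = 0" for l using arg_cong[OF e, of "\<lambda>v. v $ l"] by simp
      define w where "w = to_pillow z x"
      define N where "N = inverse (pillow_norm z x)"
      have N: "N > 0" using pillow_norm_pos[OF x0] by (simp add: N_def)
      have wl: "w $ l = N * x $ l" for l by (simp add: w_def to_pillow_def N_def)
      have wP: "w \<in> pillow z" unfolding w_def by (rule to_pillow_in[OF x0])
      have others: "x $ l = 0" if "l \<noteq> i" "l \<noteq> z" for l
      proof -
        have "N * x $ l + c * x $ l = 0"
          using e'[of l] that by (simp add: pillow_fold_def fold_cube_def D_def wl flip: w_def)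
        then have "(N + c) * x $ l = 0" by (simp only: distrib_right)
        then show ?thesis using N c by simp
      qed
      have ei: "2 * \<bar>w $ i\<bar> - 1 + c * ((x $ i)\<^sup>2 - (x $ z)\<^sup>2) = 0"
        using e'[of i] iz by (simp add: pillow_fold_def fold_cube_def D_def flip: w_def)
      define m where "m = 1 - infnorm (flat z (fold_cube {i} w))"
      have m: "m \<ge> 0" using fold_cube_flat_le_1[OF wP, of "{i}"] by (simp add: m_def)
      have ez: "sgn (w $ z) * sgn (w $ i) * m + c * (2 * x $ i * x $ z) = 0"
        using e'[of z] iz by (simp add: pillow_fold_def D_def m_def flip: w_def)
      have "x $ i = 0 \<or> x $ z = 0"
      proof (rule ccontr)
        assume n: "\<not> (x $ i = 0 \<or> x $ z = 0)"
        have "sgn (w $ z) * sgn (w $ i) = sgn (x $ i * x $ z)" using N by (simp add: wl sgn_mult)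
        then have "sgn (x $ i * x $ z) * m + 2 * c * (x $ i * x $ z) = 0" using ez by (simp add: algebra_simps)
        then have "sgn (x $ i * x $ z) * m * sgn (x $ i * x $ z) + 2 * c * (x $ i * x $ z) * sgn (x $ i * x $ z) = 0"
          by (metis distrib_right mult_zero_left)
        moreover have "x $ i * x $ z \<noteq> 0" using n by simp
        then have "sgn (x $ i * x $ z) * m * sgn (x $ i * x $ z) = m"
          "2 * c * (x $ i * x $ z) * sgn (x $ i * x $ z) = 2 * c * \<bar>x $ i * x $ z\<bar>" "\<bar>x $ i * x $ z\<bar> > 0"
          by (auto simp: sgn_if)
        ultimately have "m + 2 * c * \<bar>x $ i * x $ z\<bar> = 0" by simp
        moreover have "2 * c * \<bar>x $ i * x $ z\<bar> > 0" using c \<open>\<bar>x $ i * x $ z\<bar> > 0\<close> by (intro mult_pos_pos) auto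
        ultimately show False using m by linarith
      qed
      then show False
      proof
        assume i0: "x $ i = 0"
        have "c * (x $ z)\<^sup>2 \<ge> 0" using c by simp
        then show False using ei by (simp add: wl i0)
      next
        assume z0: "x $ z = 0"
        have "\<bar>w $ l\<bar> \<le> \<bar>w $ i\<bar>" if "l \<noteq> z" for l using others[of l] that by (cases "l = i") (auto simp: wl)
        then have "infnorm (flat z w) \<le> \<bar>w $ i\<bar>" by (simp add: infnorm_flat_le_iff)
        then have "\<bar>w $ i\<bar> \<ge> 1" using wP z0 by (simp add: pillow_def pillow_norm_def wl)
        moreover have "c * (x $ i)\<^sup>2 \<ge> 0" using c by simp
        ultimately show False using ei by (simp add: z0)
      qed
    qed
  qed
  also have "\<dots> = 2" unfolding D_def[abs_def] by (rule sphere_degree_double[OF iz])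
  finally show ?thesis by (simp add: pillow_degree_def)
qed

lemma pillow_degree_fold:
  assumes "finite J" "z \<notin> J"
  shows "pillow_degree z (pillow_fold z J) = 2 ^ card J"
  using assms
proof (induction J)
  case empty
  have "pillow_fold z {} x = x" if "x \<in> pillow z" for x
  proof -
    have "1 - infnorm (flat z x) = \<bar>x $ z\<bar>" using that by (simp add: pillow_def pillow_norm_def)
    then show ?thesis by (simp add: pillow_fold_def fold_cube_def vec_eq_iff sgn_mult_abs)
  qed
  then have "sphere_degree (pillow_fold z {} \<circ> to_pillow z) = sphere_degree ((\<lambda>x. x) \<circ> to_pillow z)"
    by (intro sphere_degree_cong) (use to_pillow_image[of z] in fastforce)
  then show ?case using pillow_degree_id[of z] by (simp add: pillow_degree_def)
next
  case (insert i J)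
  have iz: "i \<noteq> z" "z \<notin> J" using insert by auto
  have "pillow_degree z (pillow_fold z (insert i J)) = pillow_degree z (pillow_fold z {i} \<circ> pillow_fold z J)"
    unfolding pillow_degree_def
    by (intro sphere_degree_cong) (use to_pillow_image[of z] pillow_fold_insert[OF _ insert.prems insert.hyps(2)] in fastforce)
  also have "\<dots> = 2 * 2 ^ card J"
    using insert iz
    by (subst pillow_degree_compose)
      (auto simp: pillow_degree_fold_singleton continuous_on_pillow_fold intro: pillow_fold_in)
  finally show ?case using insert by simp
qed

text \<open>Wraps the unit cube around the pillow: the inner half covers the side \<open>z > 0\<close>, the outer half the other
  side, and the boundary goes to the vertex \<open>axis z (-1)\<close>. Clamping instead of rescaling radially keeps
  the Lipschitz estimates free of divisions.\<close>

definition clamp_abs :: "real \<Rightarrow> real \<Rightarrow> real" where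
  "clamp_abs h a = max (- h) (min a h)"

definition cube_to_pillow :: "'n \<Rightarrow> real^'n::finite \<Rightarrow> real^'n" where
  "cube_to_pillow z u = (let s = min 1 (infnorm (flat z u)) in
     \<chi> i. if i = z then 1 - 2 * s else clamp_abs (2 - 2 * s) (2 * u $ i))"

lemma cube_to_pillow_in: "cube_to_pillow z u \<in> pillow z"
proof -
  define s where "s = min 1 (infnorm (flat z u))"
  have s: "0 \<le> s" "s \<le> 1" using infnorm_pos_le[of "flat z u"] by (auto simp: s_def)
  define w where "w = cube_to_pillow z u"
  have wz: "w $ z = 1 - 2 * s" by (simp add: w_def cube_to_pillow_def s_def Let_def)
  have wi: "w $ i = clamp_abs (2 - 2 * s) (2 * u $ i)" if "i \<noteq> z" for i
    using that by (simp add: w_def cube_to_pillow_def s_def Let_def)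
  \<comment> \<open>For \<open>s \<le> 1 / 2\<close> nothing is clamped and the largest modulus is
    \<open>2 * s\<close>; beyond that the largest coordinate is clamped to \<open>2 - 2 * s\<close>.
    The right side covers both cases.\<close>
  have "infnorm (flat z w) = 1 - \<bar>1 - 2 * s\<bar>"
  proof (rule antisym)
    have "\<bar>w $ i\<bar> \<le> 1 - \<bar>1 - 2 * s\<bar>" if "i \<noteq> z" for i
      using component_le_infnorm_flat[OF that, of u]
      by (cases "infnorm (flat z u) \<le> 1") (auto simp: wi[OF that] clamp_abs_def s_def max_def min_def abs_if)
    then show "infnorm (flat z w) \<le> 1 - \<bar>1 - 2 * s\<bar>" using s by (subst infnorm_flat_le_iff) auto
    show "1 - \<bar>1 - 2 * s\<bar> \<le> infnorm (flat z w)"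
    proof (cases "infnorm (flat z u) > 0")
      case True
      then obtain j where j: "j \<noteq> z" "infnorm (flat z u) = \<bar>u $ j\<bar>" using infnorm_flat_attained by blast
      have "1 - \<bar>1 - 2 * s\<bar> \<le> \<bar>w $ j\<bar>" 
        using j by (cases "\<bar>u $ j\<bar> \<le> 1") (auto simp: wi[OF j(1)] clamp_abs_def s_def max_def min_def abs_if)
      then show ?thesis using component_le_infnorm_flat[OF j(1), of w] by linarith
    next
      case False
      then have "s = 0" using s by (simp add: s_def)
      then show ?thesis using infnorm_pos_le by simp
    qed
  qed
  then show ?thesis using wz by (simp add: pillow_def pillow_norm_def w_def)
qed

lemma clamp_abs_lipschitz:
  "\<bar>a - a'\<bar> \<le> d \<Longrightarrow> \<bar>h - h'\<bar> \<le> d \<Longrightarrow> \<bar>clamp_abs h a - clamp_abs h' a'\<bar> \<le> d"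
  by (auto simp: clamp_abs_def max_def min_def abs_if split: if_splits)

lemma cube_to_pillow_lipschitz:
  "infnorm (cube_to_pillow z u - cube_to_pillow z u') \<le> 2 * infnorm (flat z (u - u'))"
proof -
  let ?d = "infnorm (flat z (u - u'))"
  define s where "s = min 1 (infnorm (flat z u))"
  define s' where "s' = min 1 (infnorm (flat z u'))"
  have ss: "\<bar>s - s'\<bar> \<le> ?d" using infnorm_flat_diff[of z u u'] by (auto simp: s_def s'_def)
  have "\<bar>cube_to_pillow z u $ i - cube_to_pillow z u' $ i\<bar> \<le> 2 * ?d" for i
  proof (cases "i = z")
    case True then show ?thesis using ss by (simp add: cube_to_pillow_def Let_def flip: s_def s'_def)
  next
    case False
    have "\<bar>clamp_abs (2 - 2 * s) (2 * u $ i) - clamp_abs (2 - 2 * s') (2 * u' $ i)\<bar> \<le> 2 * ?d"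
      using component_le_infnorm_flat[OF False, of "u - u'"] ss by (intro clamp_abs_lipschitz) auto
    then show ?thesis using False by (simp add: cube_to_pillow_def Let_def flip: s_def s'_def)
  qed
  then show ?thesis by (simp add: infnorm_le_iff)
qed

lemma cube_to_pillow_outside:
  assumes "infnorm (flat z u) \<ge> 1"
  shows "cube_to_pillow z u = axis z (-1)"
  using assms by (simp add: cube_to_pillow_def vec_eq_iff axis_def clamp_abs_def)

lemma continuous_on_cube_to_pillow: "continuous_on S (cube_to_pillow z)"
proof (rule continuous_on_infnorm_lipschitz[where L = 2])
  fix x y show "infnorm (cube_to_pillow z x - cube_to_pillow z y) \<le> 2 * infnorm (x - y)"
    using cube_to_pillow_lipschitz[of z x y] infnorm_flat_le[of z "x - y"] by linarith
qed

section \<open>Wrapping a spherical patch around the pillow\<close>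

text \<open>\<open>cube_to_pillow\<close> sees only the horizontal coordinates. Without the case
  split a mirror image of the patch, of opposite orientation, would sit on the lower
  hemisphere.\<close>

definition patch_map :: "'n \<Rightarrow> real^'n \<Rightarrow> real \<Rightarrow> real^'n::finite \<Rightarrow> real^'n" where
  "patch_map z p r x = (if x $ z \<le> 0 then axis z (-1) else cube_to_pillow z ((x - p) /\<^sub>R r))"

lemma axis_in_pillow: "axis (z::'n::finite) (-1) \<in> pillow z"
proof -
  have "flat z (axis z (-1)) = (0 :: real^'n)" by (simp add: flat_def vec_eq_iff axis_def)
  then show ?thesis by (simp add: pillow_def pillow_norm_def infnorm_0)
qed

lemma patch_map_in: "patch_map z p r x \<in> pillow z"
  by (simp add: patch_map_def axis_in_pillow cube_to_pillow_in)

lemma infnorm_flat_divide: "0 < r \<Longrightarrow> infnorm (flat z (x /\<^sub>R r)) = infnorm (flat z x) / r"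
  by (simp only: flat_scaleR infnorm_mul) (simp add: divide_inverse)

lemma patch_map_outside:
  assumes "0 < r" "r \<le> infnorm (flat z (x - p))"
  shows "patch_map z p r x = axis z (-1)"
proof -
  have "infnorm (flat z ((x - p) /\<^sub>R r)) \<ge> 1"
    using assms by (simp only: infnorm_flat_divide) simp
  then show ?thesis by (simp add: patch_map_def cube_to_pillow_outside)
qed

text \<open>On the unit sphere the sup norm is at least \<open>1 / sqrt CARD('n)\<close>, so the
  equator does not enter the interior of the cube over which the patch lies. This makes the two
  cases of \<open>patch_map\<close> fit together.\<close>

lemma infnorm_flat_equator:
  fixes x p :: "real^'n::finite"
  assumes "norm x = 1" "x $ z = 0" and "infnorm p + r \<le> 1 / sqrt CARD('n)"
  shows "r \<le> infnorm (flat z (x - p))"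
proof -
  have "flat z x = x" using assms(2) by (auto simp: flat_def vec_eq_iff)
  then have "1 \<le> sqrt CARD('n) * infnorm (flat z x)" using norm_le_infnorm[of x] assms(1) by simp
  then have "1 / sqrt CARD('n) \<le> infnorm (flat z x)" by (simp add: field_simps)
  then show ?thesis
    using infnorm_flat_diff[of z x p] infnorm_flat_le[of z p] infnorm_flat_diff[of z x "x - p"] assms(3)
    by auto
qed

text \<open>The parameter slides the patch to the pole; \<open>t *\<^sub>R p\<close> obeys the same
  bound as \<open>p\<close>.\<close>

lemma continuous_on_patch_homotopy:
  fixes p :: "real^'n::finite"
  assumes r: "0 < r" and pr: "infnorm p + r \<le> 1 / sqrt CARD('n)"
  shows "continuous_on ({0..1} \<times> sphere 0 1) (\<lambda>(t, x). patch_map z (t *\<^sub>R p) r x)"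
proof -
  have "continuous_on ({0..1} \<times> sphere 0 1)
     (\<lambda>y. if snd y $ z \<le> 0 then axis z (-1) else cube_to_pillow z ((snd y - fst y *\<^sub>R p) /\<^sub>R r))"
  proof (rule continuous_on_cases_le)
    show "continuous_on {y \<in> {0..1} \<times> sphere 0 1. 0 \<le> snd y $ z} (\<lambda>y. cube_to_pillow z ((snd y - fst y *\<^sub>R p) /\<^sub>R r))"
      by (rule continuous_on_compose2[OF continuous_on_cube_to_pillow[of UNIV]]) (auto intro!: continuous_intros)
    fix y :: "real \<times> (real^'n)" assume y: "y \<in> {0..1} \<times> sphere 0 1" "snd y $ z = 0"
    have "infnorm (fst y *\<^sub>R p) \<le> infnorm p"
      using y infnorm_pos_le[of p] by (auto simp: infnorm_mul mult_left_le_one_le)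
    then have "r \<le> infnorm (flat z (snd y - fst y *\<^sub>R p))"
      using y pr by (intro infnorm_flat_equator) auto
    then have "infnorm (flat z ((snd y - fst y *\<^sub>R p) /\<^sub>R r)) \<ge> 1"
      using r by (simp only: infnorm_flat_divide) simp
    then show "axis z (-1) = cube_to_pillow z ((snd y - fst y *\<^sub>R p) /\<^sub>R r)"
      by (simp add: cube_to_pillow_outside)
  qed (auto intro!: continuous_intros)
  then show ?thesis by (simp add: patch_map_def case_prod_unfold)
qed

lemma continuous_on_patch_map:
  fixes p :: "real^'n::finite"
  assumes r: "0 < r" and pr: "infnorm p + r \<le> 1 / sqrt CARD('n)"
  shows "continuous_on (sphere 0 1) (patch_map z p r)"
proof -
  have "continuous_on (sphere 0 1) (\<lambda>x. (\<lambda>(t, x). patch_map z (t *\<^sub>R p) r x) (1, x))"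
    by (rule continuous_on_compose2[OF continuous_on_patch_homotopy[OF assms]]) (auto intro!: continuous_intros)
  then show ?thesis by simp
qed

text \<open>Once slid to the pole, the patch map is never opposite to the identity: on the lower
  half it points straight down, on the upper half no horizontal coordinate is reversed, and the pole
  goes to the top vertex.\<close>

lemma sphere_degree_patch_map:
  fixes p :: "real^'n::finite"
  assumes r: "0 < r" and pr: "infnorm p + r \<le> 1 / sqrt CARD('n)"
  shows "sphere_degree (patch_map z p r) = 1"
proof -
  have hom: "homotopic_with_canon (\<lambda>_. True) (sphere 0 1) (-{0}) (patch_map z (0 *\<^sub>R p) r) (patch_map z (1 *\<^sub>R p) r)"
    unfolding homotopic_with_def
  proof (intro exI conjI allI ballI)
    show "continuous_map (prod_topology (top_of_set {0..1}) (top_of_set (sphere 0 1))) (top_of_set (-{0}))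
        (\<lambda>(t, x). patch_map z (t *\<^sub>R p) r x)"
      using continuous_on_patch_homotopy[OF assms, of z] patch_map_in[THEN pillow_nonzero]
      by (auto simp flip: subtopology_Times)
  qed auto
  have r0: "infnorm (0 :: real^'n) + r \<le> 1 / sqrt CARD('n)" using pr infnorm_pos_le[of p] by (simp add: infnorm_0)
  have "sphere_degree (patch_map z p r) = sphere_degree (patch_map z 0 r)"
    using sphere_degree_homotopic[OF hom] by simp
  also have "\<dots> = sphere_degree (\<lambda>x::real^'n. x)"
  proof (rule sphere_degree_not_opposite)
    show "continuous_on (sphere 0 1) (patch_map z 0 r)" by (rule continuous_on_patch_map[OF r r0])
    fix x :: "real^'n" assume x: "norm x = 1"
    show "patch_map z 0 r x \<noteq> 0" by (rule patch_map_in[THEN pillow_nonzero])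
    show "x \<noteq> 0" using x by auto
    fix c :: real assume c: "0 < c"
    show "patch_map z 0 r x + c *\<^sub>R x \<noteq> 0"
    proof
      assume e: "patch_map z 0 r x + c *\<^sub>R x = 0"
      have e': "patch_map z 0 r x $ i + c * x $ i = 0" for i using arg_cong[OF e, of "\<lambda>v. v $ i"] by simp
      show False
      proof (cases "x $ z \<le> 0")
        case True
        then have "c * x $ z \<le> 0" using c by (simp add: mult_le_0_iff)
        then show False using e'[of z] True by (simp add: patch_map_def axis_def)
      next
        case False
        define u where "u = x /\<^sub>R r"
        have K: "patch_map z 0 r x = cube_to_pillow z u" using False by (simp add: patch_map_def u_def)
        have "x $ i = 0" if "i \<noteq> z" for i
        proof -
          define h where "h = 2 - 2 * min 1 (infnorm (flat z u))"
          have h: "h \<ge> 0" by (simp add: h_def)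
          have eq: "clamp_abs h (2 * u $ i) + c * x $ i = 0"
            using e'[of i] that by (simp add: K cube_to_pillow_def h_def Let_def)
          have "x $ i = r * u $ i" using r by (simp add: u_def)
          then have sg: "(u $ i > 0 \<longleftrightarrow> x $ i > 0) \<and> (u $ i < 0 \<longleftrightarrow> x $ i < 0)"
            using r by (simp add: zero_less_mult_iff mult_less_0_iff)
          consider "x $ i > 0" | "x $ i < 0" | "x $ i = 0" by linarith
          then show ?thesis
          proof cases
            case 1
            then have "c * x $ i > 0" "u $ i > 0" using c sg by auto
            then show ?thesis using eq h by (auto simp: clamp_abs_def max_def min_def split: if_splits)
          next
            case 2
            then have "c * x $ i < 0" "u $ i < 0" using c sg by (auto simp: mult_less_0_iff)
            then show ?thesis using eq h by (auto simp: clamp_abs_def max_def min_def split: if_splits)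
          qed
        qed
        then have "flat z u = 0" by (simp add: flat_def vec_eq_iff u_def)
        then have "patch_map z 0 r x $ z = 1" by (simp add: K cube_to_pillow_def infnorm_0)
        moreover have "c * x $ z > 0" using c False by simp
        ultimately show False using e'[of z] by simp
      qed
    qed
  qed auto
  finally show ?thesis by (simp add: sphere_degree_id)
qed

section \<open>Iterates of the full fold\<close>

definition corner :: "'n \<Rightarrow> real^'n::finite" where
  "corner z = (\<chi> i. if i = z then 0 else 1)"

definition wrap :: "'n \<Rightarrow> nat \<Rightarrow> real^'n::finite \<Rightarrow> real^'n" where
  "wrap z m = pillow_fold z (- {z}) ^^ m"

lemma wrap_props:
  fixes z :: "'n::finite"
  shows "continuous_on (pillow z) (wrap z m)" "wrap z m \<in> pillow z \<rightarrow> pillow z"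
    "pillow_degree z (wrap z m) = 2 ^ (m * (CARD('n) - 1))"
proof -
  have "pillow_fold z (-{z}) \<in> pillow z \<rightarrow> pillow z" by (auto intro: pillow_fold_in)
  moreover have "continuous_on (pillow z) (pillow_fold z (-{z}))" by (rule continuous_on_pillow_fold) simp
  moreover have "pillow_degree z (pillow_fold z (-{z})) = 2 ^ (CARD('n) - 1)"
    by (subst pillow_degree_fold) (auto simp: Compl_eq_Diff_UNIV card_Diff_singleton)
  ultimately show "continuous_on (pillow z) (wrap z m)" "wrap z m \<in> pillow z \<rightarrow> pillow z"
    "pillow_degree z (wrap z m) = 2 ^ (m * (CARD('n) - 1))"
    using pillow_degree_funpow[of z "pillow_fold z (-{z})" m]
    by (simp_all add: wrap_def power_mult[symmetric] mult.commute)
qed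

lemma wrap_in: "x \<in> pillow z \<Longrightarrow> wrap z m x \<in> pillow z"
  using wrap_props(2) by blast

lemma wrap_lipschitz:
  assumes "x \<in> pillow z" "y \<in> pillow z"
  shows "infnorm (wrap z m x - wrap z m y) \<le> 2 ^ m * infnorm (x - y)"
proof (induction m)
  case 0 then show ?case by (simp add: wrap_def)
next
  case (Suc m)
  have "infnorm (wrap z (Suc m) x - wrap z (Suc m) y) \<le> 2 * infnorm (wrap z m x - wrap z m y)"
    using pillow_fold_lipschitz[OF wrap_in[OF assms(1)] wrap_in[OF assms(2)], of "-{z}" m m]
    by (simp add: wrap_def)
  then show ?case using Suc by simp
qed

text \<open>The bottom vertex goes to the point whose horizontal coordinates are all -1, that point
  to \<open>corner z\<close>, and \<open>corner z\<close> is fixed. From two iterations on, the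
  value on the collapsed boundary of a patch is thus independent of \<open>m\<close>.\<close>

lemma wrap_axis:
  assumes n: "CARD('n::finite) \<ge> 2" and m: "m \<ge> 2"
  shows "wrap z m (axis z (-1)) = (corner z :: real^'n)"
proof -
  let ?f = "pillow_fold z (- {z}) :: real^'n \<Rightarrow> real^'n"
  obtain j where j: "j \<noteq> z"
  proof -
    have "UNIV \<noteq> {z}" using n by (metis card.empty card_insert_disjoint empty_iff finite.emptyI not_less_eq_eq numeral_2_eq_2 One_nat_def le_refl)
    then show ?thesis using that by auto
  qed
  define b where "b = ((\<chi> i. if i = z then 0 else -1) :: real^'n)"
  have 1: "?f (axis z (-1)) = b"
  proof -
    have a: "fold_cube (-{z}) (axis z (-1)) $ i = (if i = z then -1 else -1)" for i :: 'n
      by (simp add: fold_cube_def axis_def)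
    have p: "(\<Prod>l\<in>-{z}. sgn (axis z (-1) $ l :: real)) = 0"
      using j by (intro prod_zero) (auto simp: axis_def)
    show ?thesis unfolding b_def pillow_fold_def a p by (simp add: vec_eq_iff)
  qed
  have 2: "?f b = corner z"
    by (simp add: pillow_fold_def fold_cube_def b_def corner_def vec_eq_iff)
  have 3: "?f (corner z) = corner z"
    by (simp add: pillow_fold_def fold_cube_def corner_def vec_eq_iff)
  obtain l where l: "m = l + 2" using m by (metis add.commute le_Suc_ex)
  have "(?f ^^ l) (corner z) = corner z" by (induction l) (simp_all add: 3)
  then show ?thesis
    unfolding wrap_def l funpow_add by (simp add: numeral_2_eq_2 1 2)
qed

text \<open>The value at \<open>w\<close> can be moved to the origin linearly because \<open>w\<close> lies inside the pillow.\<close>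

lemma sphere_degree_wrapped_patch:
  fixes p q w :: "real^'n::finite"
  assumes r: "0 < r" and pr: "infnorm p + r \<le> 1 / sqrt CARD('n)" and s: "0 < s" and w: "infnorm w < 1 / 2"
  shows "sphere_degree (\<lambda>x. (q + s *\<^sub>R wrap z m (patch_map z p r x)) - (q + s *\<^sub>R w)) = 2 ^ (m * (CARD('n) - 1))"
proof -
  let ?K = "patch_map z p r"
  have cK: "continuous_on (sphere 0 1) ?K" by (rule continuous_on_patch_map[OF r pr])
  have cFK: "continuous_on (sphere 0 1) (wrap z m \<circ> ?K)"
    by (rule continuous_on_compose[OF cK continuous_on_subset[OF wrap_props(1)]]) (auto intro: patch_map_in)
  have "sphere_degree (\<lambda>x. (q + s *\<^sub>R wrap z m (?K x)) - (q + s *\<^sub>R w)) = sphere_degree (wrap z m \<circ> ?K)"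
  proof (rule sphere_degree_linear_homotopy)
    show "continuous_on (sphere 0 1) (\<lambda>x. (q + s *\<^sub>R wrap z m (?K x)) - (q + s *\<^sub>R w))"
      using cFK unfolding o_def by (intro continuous_intros)
    fix x :: "real^'n" and t :: real assume t: "0 \<le> t" "t \<le> 1"
    let ?v = "wrap z m (?K x)" and ?a = "(1 - t) * s + t"
    have v: "pillow_norm z ?v = 1" using wrap_in[OF patch_map_in] by (auto simp: pillow_def)
    \<comment> \<open>The origin of 1/2: \<open>pillow_norm\<close> is at most twice
      \<open>infnorm\<close>.\<close>
    have wN: "pillow_norm z w < 1"
      using w infnorm_flat_le[of z w] component_le_infnorm_cart[of w z] by (simp add: pillow_norm_def)
    have a: "?a > 0" using t s by (cases "t = 0") (auto intro: add_nonneg_pos)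
    have eq: "(1 - t) *\<^sub>R ((q + s *\<^sub>R ?v) - (q + s *\<^sub>R w)) + t *\<^sub>R (wrap z m \<circ> ?K) x = ?a *\<^sub>R ?v - ((1 - t) * s) *\<^sub>R w"
      by (simp add: algebra_simps)
    show "(1 - t) *\<^sub>R ((q + s *\<^sub>R ?v) - (q + s *\<^sub>R w)) + t *\<^sub>R (wrap z m \<circ> ?K) x \<noteq> 0"
    proof
      assume "(1 - t) *\<^sub>R ((q + s *\<^sub>R ?v) - (q + s *\<^sub>R w)) + t *\<^sub>R (wrap z m \<circ> ?K) x = 0"
      then have "?a *\<^sub>R ?v = ((1 - t) * s) *\<^sub>R w" unfolding eq by simp
      then have "pillow_norm z (?a *\<^sub>R ?v) = pillow_norm z (((1 - t) * s) *\<^sub>R w)" by simp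
      then have "?a = (1 - t) * s * pillow_norm z w" using v a t s by (simp add: pillow_norm_scaleR)
      moreover have "(1 - t) * s * pillow_norm z w \<le> (1 - t) * s * 1" using t s wN by (intro mult_left_mono) auto
      ultimately have "t = 0" using t by linarith
      then show False using \<open>?a = (1 - t) * s * pillow_norm z w\<close> s wN by simp
    qed
  qed (rule cFK)
  also have "\<dots> = pillow_degree z (wrap z m) * sphere_degree ?K"
    by (rule sphere_degree_pillow_compose[OF wrap_props(1,2) cK]) (auto intro: patch_map_in)
  finally show ?thesis by (simp add: wrap_props(3) sphere_degree_patch_map[OF r pr])
qed

section \<open>The map\<close>

lemma min_1_le_powr:
  assumes "0 \<le> u" "0 < a" "a \<le> 1"
  shows "min 1 u \<le> u powr (a::real)"
proof (cases "u \<ge> 1")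
  case True
  then show ?thesis using ge_one_powr_ge_zero[of u a] assms by simp
next
  case False
  show ?thesis
  proof (cases "u = 0")
    case False
    then have "u powr 1 \<le> u powr a" using assms \<open>\<not> u \<ge> 1\<close> by (intro powr_mono') auto
    then show ?thesis using assms by simp
  qed simp
qed

lemma holder_imp_continuous_on:
  fixes f :: "'a::metric_space \<Rightarrow> 'b::metric_space"
  assumes a: "0 < a" and h: "\<And>x y. x \<in> S \<Longrightarrow> y \<in> S \<Longrightarrow> dist (f x) (f y) \<le> C * dist x y powr a"
  shows "continuous_on S f"
  unfolding continuous_on
proof
  fix y assume y: "y \<in> S"
  have "((\<lambda>x. dist x y powr a) \<longlongrightarrow> 0) (at y within S)"
  proof (rule tendsto_zero_powrI[OF _ tendsto_const _ a])
    show "((\<lambda>x. dist x y) \<longlongrightarrow> 0) (at y within S)"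
      using tendsto_dist[OF tendsto_ident_at[of y S] tendsto_const[of y]] by simp
  qed simp
  then have "((\<lambda>x. C * dist x y powr a) \<longlongrightarrow> 0) (at y within S)" by (rule tendsto_mult_right_zero)
  moreover have le: "\<forall>\<^sub>F x in at y within S. dist (f x) (f y) \<le> C * dist x y powr a"
    using h y by (auto simp: eventually_at_filter)
  ultimately have "((\<lambda>x. dist (f x) (f y)) \<longlongrightarrow> 0) (at y within S)"
    by (intro tendsto_sandwich[OF _ le tendsto_const]) simp_all
  then show "(f \<longlongrightarrow> f y) (at y within S)" by (rule iffD2[OF tendsto_dist_iff])
qed

lemma closure_extension_eq:
  fixes v :: "'a::euclidean_space \<Rightarrow> 'b::t2_space"
  assumes v: "continuous_on (cball 0 1) v" and x: "x \<in> cball 0 1"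
  shows "closure_extension (ball 0 1) v x = v x"
proof (cases "x \<in> ball 0 1")
  case False
  have "(v \<longlongrightarrow> v x) (at x within cball 0 1)" using v x by (simp add: continuous_on)
  then have "(v \<longlongrightarrow> v x) (at x within ball 0 1)" by (rule tendsto_within_subset) auto
  moreover have "at x within ball 0 1 \<noteq> bot"
    using False x by (simp add: trivial_limit_within islimpt_ball)
  ultimately show ?thesis using False by (simp add: closure_extension_def tendsto_Lim)
qed (simp add: closure_extension_def)

text \<open>\<open>r k\<close> is the radius of the k-th patch and \<open>s k\<close> the size of
  its pillow. The bound on \<open>r0\<close> keeps all bubbles horizontally within
  \<open>10 * r0\<close>, at most half of \<open>1 / sqrt CARD('n)\<close>, of the z-axis;
  \<open>m2\<close> fixes the point where a pillow is attached, \<open>s4\<close> separates the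
  slabs, and \<open>s\<alpha>\<close> yields the Hoelder bound.\<close>

locale bubbles =
  fixes z i1 :: "'n::finite" and \<alpha> r0 :: real and m :: "nat \<Rightarrow> nat" and r s :: "nat \<Rightarrow> real"
  assumes i1: "i1 \<noteq> z" and \<alpha>: "0 < \<alpha>" "\<alpha> \<le> 1"
    and r0: "0 < r0" "20 * r0 \<le> 1 / sqrt CARD('n)" and r: "\<And>k. r k = r0 / 2 ^ k"
    and m2: "\<And>k. 2 \<le> m k" and s0: "\<And>k. 0 < s k" and s4: "\<And>k. s k \<le> r k / 4"
    and s\<alpha>: "\<And>k. s k \<le> (r k / 2 ^ m k) powr \<alpha>"
begin

lemma n2: "CARD('n) \<ge> 2"
proof -
  have "card {i1, z} \<le> CARD('n)" by (rule card_mono) auto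
  then show ?thesis using i1 by simp
qed

lemma r_pos: "0 < r k" and r_le: "r k \<le> r0" and r_le_1: "r k \<le> 1"
proof -
  show "0 < r k" using r0 by (simp add: r)
  show 1: "r k \<le> r0" using r0 by (simp add: r field_simps)
  have "1 / sqrt CARD('n) \<le> 1" using n2 by simp
  then show "r k \<le> 1" using 1 r0 by linarith
qed

lemma r_half: "j < k \<Longrightarrow> r k \<le> r j / 2"
proof -
  assume "j < k"
  then obtain l where "k = Suc (j + l)" using less_imp_Suc_add by blast
  then show ?thesis using r0 by (simp add: r power_add field_simps)
qed

text \<open>A bubble has radius \<open>2 * r k\<close>, so its \<open>i1\<close>-coordinates lie
  between \<open>6 * r k\<close> and \<open>10 * r k\<close>. As the radii are halved, these ranges
  are disjoint.\<close>

definition center :: "nat \<Rightarrow> real^'n" where "center k = axis i1 (8 * r k)"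

definition center_dist :: "nat \<Rightarrow> real^'n \<Rightarrow> real" where "center_dist k x = infnorm (flat z (x - center k))"

text \<open>Lifts the pillow to height \<open>r k\<close>: constant over the patch, then a ramp of
  slope 1 on which the bubble runs along the z-axis.\<close>

definition plateau :: "nat \<Rightarrow> real^'n \<Rightarrow> real" where
  "plateau k x = max 0 (min (r k) (2 * r k - center_dist k x))"

definition bubble :: "nat \<Rightarrow> real^'n \<Rightarrow> real^'n" where
  "bubble k x = axis z (plateau k x)
     + s k *\<^sub>R (wrap z (m k) (cube_to_pillow z ((x - center k) /\<^sub>R r k)) - corner z)"

lemma infnorm_center: "infnorm (center k) \<le> 8 * r k"
  using r_pos[of k] by (auto simp: infnorm_le_iff center_def axis_def)

lemma center_bound: "infnorm (center k) + r k \<le> 1 / sqrt CARD('n)"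
  using infnorm_center[of k] r_le[of k] r_pos[of k] r0 by linarith

lemma wrapped_outside: "r k \<le> center_dist k x \<Longrightarrow> wrap z (m k) (cube_to_pillow z ((x - center k) /\<^sub>R r k)) = corner z"
proof -
  assume "r k \<le> center_dist k x"
  then have "infnorm (flat z ((x - center k) /\<^sub>R r k)) \<ge> 1"
    using r_pos[of k] by (simp add: infnorm_flat_divide center_dist_def del: scaleR_diff_right)
  then show ?thesis using wrap_axis[OF n2 m2] by (simp add: cube_to_pillow_outside)
qed

lemma bubble_outside: "2 * r k \<le> center_dist k x \<Longrightarrow> bubble k x = 0"
proof -
  assume *: "2 * r k \<le> center_dist k x"
  then have "plateau k x = 0" "r k \<le> center_dist k x" using r_pos[of k] by (auto simp: plateau_def)
  then show ?thesis by (simp add: bubble_def wrapped_outside axis_def vec_eq_iff)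
qed

lemma bubbles_disjoint:
  assumes "center_dist j x < 2 * r j" "center_dist k x < 2 * r k"
  shows "j = k"
proof (rule ccontr)
  have b: "6 * r l < x $ i1 \<and> x $ i1 < 10 * r l" if "center_dist l x < 2 * r l" for l
    using component_le_infnorm_flat[OF i1, of "x - center l"] that
    by (auto simp: center_dist_def center_def)
  have *: False if "a < b" "center_dist a x < 2 * r a" "center_dist b x < 2 * r b" for a b
    using b[OF that(2)] b[OF that(3)] r_half[OF that(1)] by linarith
  assume "j \<noteq> k"
  then show False using *[of j k] *[of k j] assms by linarith
qed

lemma wrapped_in: "wrap z (m k) (cube_to_pillow z u) \<in> pillow z"
  by (rule wrap_in[OF cube_to_pillow_in])

lemma infnorm_corner: "infnorm (corner z) \<le> 1"
  by (simp add: infnorm_le_iff corner_def)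

lemma s_le_1: "s k \<le> 1"
  using s4[of k] r_le_1[of k] r_pos[of k] by linarith

lemma infnorm_axis: "infnorm (axis z a) = \<bar>a\<bar>"
proof (rule antisym)
  show "infnorm (axis z a) \<le> \<bar>a\<bar>" by (simp add: infnorm_le_iff axis_def)
  show "\<bar>a\<bar> \<le> infnorm (axis z a)" using component_le_infnorm_cart[of "axis z a" z] by simp
qed

lemma infnorm_bubble_le: "infnorm (bubble k x) \<le> 3"
proof -
  let ?w = "wrap z (m k) (cube_to_pillow z ((x - center k) /\<^sub>R r k))"
  have "infnorm (?w - corner z) \<le> 2"
    using infnorm_triangle[of ?w "- corner z"] pillow_infnorm_le_1[OF wrapped_in, of k "(x - center k) /\<^sub>R r k"]
      infnorm_corner by (simp add: infnorm_neg)
  then have "s k * infnorm (?w - corner z) \<le> 1 * 2"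
    using s_le_1[of k] s0[of k] by (intro mult_mono) (auto simp: infnorm_pos_le)
  moreover have "\<bar>plateau k x\<bar> \<le> 1" using r_le_1[of k] r_pos[of k] by (auto simp: plateau_def)
  moreover have "infnorm (bubble k x) \<le> \<bar>plateau k x\<bar> + s k * infnorm (?w - corner z)"
    using infnorm_triangle[of "axis z (plateau k x)" "s k *\<^sub>R (?w - corner z)"] s0[of k]
    by (simp add: bubble_def infnorm_axis infnorm_mul)
  ultimately show ?thesis by linarith
qed

lemma bubble_holder: "infnorm (bubble k x - bubble k y) \<le> 3 * infnorm (x - y) powr \<alpha>"
proof -
  let ?e = "infnorm (x - y)"
  let ?u = "\<lambda>x. cube_to_pillow z ((x - center k) /\<^sub>R r k)"
  let ?w = "\<lambda>x. wrap z (m k) (?u x)"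
  have e0: "?e \<ge> 0" by (rule infnorm_pos_le)
  have dd: "\<bar>center_dist k x - center_dist k y\<bar> \<le> ?e"
    using infnorm_flat_diff[of z "x - center k" "y - center k"] infnorm_flat_le[of z "x - y"]
    by (simp add: center_dist_def)
  have lip: "\<bar>max 0 (min c (2 * c - a)) - max 0 (min c (2 * c - b))\<bar> \<le> \<bar>a - b\<bar>" for a b c :: real
    by (simp add: max_def min_def abs_minus_commute)
  have pl: "0 \<le> plateau k x \<and> plateau k x \<le> 1" for x
    using r_le_1[of k] r_pos[of k] by (simp add: plateau_def max_def min_def)
  have "\<bar>plateau k x - plateau k y\<bar> \<le> ?e"
    unfolding plateau_def by (rule order_trans[OF lip dd])
  moreover have "\<bar>plateau k x - plateau k y\<bar> \<le> 1" using pl[of x] pl[of y] by linarith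
  ultimately have "\<bar>plateau k x - plateau k y\<bar> \<le> min 1 ?e" by simp
  then have P: "\<bar>plateau k x - plateau k y\<bar> \<le> ?e powr \<alpha>" using min_1_le_powr[OF e0 \<alpha>] by linarith
  \<comment> \<open>The wrapped map varies by at most \<open>2 * ?t\<close> and by at most 2, hence
    by at most \<open>2 * ?t powr \<alpha>\<close>. The factor \<open>s k\<close> is sized to turn
    this into a bound free of \<open>k\<close>.\<close>
  let ?t = "2 ^ m k * ?e / r k"
  have t0: "?t \<ge> 0" using e0 r_pos[of k] by simp
  have "infnorm (?w x - ?w y) \<le> 2 ^ m k * infnorm (?u x - ?u y)"
    by (rule wrap_lipschitz) (rule cube_to_pillow_in)+
  also have "\<dots> \<le> 2 ^ m k * (2 * (?e / r k))"
  proof (rule mult_left_mono)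
    have "(x - center k) /\<^sub>R r k - (y - center k) /\<^sub>R r k = (x - y) /\<^sub>R r k" by (simp add: algebra_simps)
    then have "infnorm (?u x - ?u y) \<le> 2 * (infnorm (flat z (x - y)) / r k)"
      using cube_to_pillow_lipschitz[of z "(x - center k) /\<^sub>R r k" "(y - center k) /\<^sub>R r k"]
        infnorm_flat_divide[OF r_pos[of k], of z "x - y"] by simp
    also have "\<dots> \<le> 2 * (?e / r k)"
      using infnorm_flat_le[of z "x - y"] r_pos[of k] by (simp add: divide_right_mono)
    finally show "infnorm (?u x - ?u y) \<le> 2 * (?e / r k)" .
  qed simp
  also have "\<dots> = 2 * ?t" by simp
  finally have W1: "infnorm (?w x - ?w y) \<le> 2 * ?t" .
  have W2: "infnorm (?w x - ?w y) \<le> 2"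
    using infnorm_triangle[of "?w x" "- ?w y"] pillow_infnorm_le_1[OF wrapped_in, of k "(x - center k) /\<^sub>R r k"]
      pillow_infnorm_le_1[OF wrapped_in, of k "(y - center k) /\<^sub>R r k"] by (simp add: infnorm_neg)
  have "infnorm (?w x - ?w y) \<le> 2 * min 1 ?t" using W1 W2 by (simp add: min_def)
  also have "\<dots> \<le> 2 * ?t powr \<alpha>" using min_1_le_powr[OF t0 \<alpha>] by simp
  finally have W: "infnorm (?w x - ?w y) \<le> 2 * ?t powr \<alpha>" .
  have "s k * infnorm (?w x - ?w y) \<le> (r k / 2 ^ m k) powr \<alpha> * (2 * ?t powr \<alpha>)"
    using s\<alpha>[of k] s0[of k] W by (intro mult_mono) (auto simp: infnorm_pos_le)
  also have "\<dots> = 2 * ((r k / 2 ^ m k) * ?t) powr \<alpha>"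
  proof -
    have "((r k / 2 ^ m k) * ?t) powr \<alpha> = (r k / 2 ^ m k) powr \<alpha> * ?t powr \<alpha>"
      by (rule powr_mult)
    then show ?thesis by (simp only: mult.left_commute)
  qed
  also have "(r k / 2 ^ m k) * ?t = ?e" using r_pos[of k] by simp
  finally have S: "s k * infnorm (?w x - ?w y) \<le> 2 * ?e powr \<alpha>" .
  have "bubble k x - bubble k y = axis z (plateau k x - plateau k y) + s k *\<^sub>R (?w x - ?w y)"
    by (simp add: bubble_def vec_eq_iff axis_def algebra_simps)
  then have "infnorm (bubble k x - bubble k y) \<le> \<bar>plateau k x - plateau k y\<bar> + s k * infnorm (?w x - ?w y)"
    using infnorm_triangle[of "axis z (plateau k x - plateau k y)" "s k *\<^sub>R (?w x - ?w y)"] s0[of k]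
    by (simp add: infnorm_axis infnorm_mul)
  then show ?thesis using P S by linarith
qed

text \<open>The sum of all bubbles without a series: their supports are disjoint, and where no index
  qualifies, whatever \<open>SOME\<close> picks gives 0.\<close>

definition bubble_sum :: "real^'n \<Rightarrow> real^'n" where
  "bubble_sum x = bubble (SOME k. center_dist k x < 2 * r k) x"

lemma bubble_sum_eq: "center_dist k x < 2 * r k \<Longrightarrow> bubble_sum x = bubble k x"
  unfolding bubble_sum_def by (metis (mono_tags, lifting) bubbles_disjoint someI)

lemma bubble_sum_eq_0: "(\<And>k. 2 * r k \<le> center_dist k x) \<Longrightarrow> bubble_sum x = 0"
  unfolding bubble_sum_def by (rule bubble_outside)

lemma bubble_sum_cases: "\<exists>k. bubble_sum x = bubble k x \<and> (\<forall>j. j \<noteq> k \<longrightarrow> bubble j x = 0)"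
proof (cases "\<exists>k. center_dist k x < 2 * r k")
  case True
  then obtain k where k: "center_dist k x < 2 * r k" by blast
  have "bubble j x = 0" if "j \<noteq> k" for j
    using bubbles_disjoint[OF _ k, of j] that by (intro bubble_outside) force
  then show ?thesis using bubble_sum_eq[OF k] by blast
next
  case False
  then have "bubble j x = 0" for j by (intro bubble_outside) (simp add: not_less)
  then show ?thesis by (auto simp: bubble_sum_def)
qed

lemma bubble_sum_holder: "infnorm (bubble_sum x - bubble_sum y) \<le> 6 * infnorm (x - y) powr \<alpha>"
proof -
  obtain k where k: "bubble_sum x = bubble k x" "\<And>j. j \<noteq> k \<Longrightarrow> bubble j x = 0"
    using bubble_sum_cases[of x] by blast
  obtain l where l: "bubble_sum y = bubble l y" "\<And>j. j \<noteq> l \<Longrightarrow> bubble j y = 0"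
    using bubble_sum_cases[of y] by blast
  show ?thesis
  proof (cases "k = l")
    case True
    then show ?thesis using bubble_holder[of k x y] k l by (simp add: order_trans[OF bubble_holder])
  next
    case False
    \<comment> \<open>Bubble \<open>k\<close> vanishes at \<open>y\<close> and bubble
      \<open>l\<close> at \<open>x\<close>. Only two bubbles ever matter, so the constant doubles
      however many there are.\<close>
    then have "bubble_sum x - bubble_sum y = (bubble k x - bubble k y) + (bubble l x - bubble l y)"
      using k l by simp
    then show ?thesis
      using infnorm_triangle[of "bubble k x - bubble k y" "bubble l x - bubble l y"]
        bubble_holder[of k x y] bubble_holder[of l x y] by simp
  qed
qed

text \<open>All bubbles sit near the pole \<open>axis z 1\<close> of the sphere; the factor switches off their mirror
  images near the opposite pole, whose contributions to the degree would cancel them.\<close>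

definition v :: "real^'n \<Rightarrow> real^'n" where
  "v x = max 0 (min 1 (2 * x $ z)) *\<^sub>R bubble_sum x"

lemma v_holder_infnorm:
  assumes "x \<in> cball 0 1" "y \<in> cball 0 1"
  shows "infnorm (v x - v y) \<le> 18 * infnorm (x - y) powr \<alpha>"
proof -
  let ?e = "infnorm (x - y)" and ?c = "\<lambda>x::real^'n. max 0 (min 1 (2 * x $ z))"
  have e0: "?e \<ge> 0" by (rule infnorm_pos_le)
  have "norm (x - y) \<le> 2" using assms norm_triangle_ineq4[of x y] by simp
  then have e2: "?e / 2 \<le> 1" using infnorm_le_norm[of "x - y"] by simp
  have "?e / 2 = min 1 (?e / 2)" using e2 by simp
  also have "\<dots> \<le> (?e / 2) powr \<alpha>" using e0 \<alpha> by (intro min_1_le_powr) auto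
  also have "\<dots> \<le> ?e powr \<alpha>" using e0 \<alpha> by (intro powr_mono2) auto
  \<comment> \<open>The diameter 2 of the ball costs a factor 2. With Lipschitz constant 2 for the
    cutoff and the bound 3 on \<open>bubble_sum\<close>, this makes up 12 of the 18.\<close>
  finally have e: "?e \<le> 2 * ?e powr \<alpha>" by simp
  have c1: "\<bar>?c x\<bar> \<le> 1" by auto
  have c2: "\<bar>?c x - ?c y\<bar> \<le> 2 * ?e"
    using component_diff_le_infnorm[of x z y] by (auto simp: max_def min_def)
  have b3: "infnorm (bubble_sum y) \<le> 3" unfolding bubble_sum_def by (rule infnorm_bubble_le)
  have "v x - v y = ?c x *\<^sub>R (bubble_sum x - bubble_sum y) + (?c x - ?c y) *\<^sub>R bubble_sum y"
    unfolding v_def by (simp add: algebra_simps)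
  then have "infnorm (v x - v y) \<le> \<bar>?c x\<bar> * infnorm (bubble_sum x - bubble_sum y) + \<bar>?c x - ?c y\<bar> * infnorm (bubble_sum y)"
    using infnorm_triangle[of "?c x *\<^sub>R (bubble_sum x - bubble_sum y)" "(?c x - ?c y) *\<^sub>R bubble_sum y"]
    by (simp only: infnorm_mul)
  also have "\<dots> \<le> 1 * (6 * ?e powr \<alpha>) + (2 * ?e) * 3"
    by (rule add_mono[OF mult_mono[OF c1 bubble_sum_holder] mult_mono[OF c2 b3]])
      (simp_all only: infnorm_pos_le e0 zero_le_one mult_nonneg_nonneg zero_le_numeral)
  finally show ?thesis using e by linarith
qed

lemma v_holder:
  assumes "x \<in> cball 0 1" "y \<in> cball 0 1"
  shows "dist (v x) (v y) \<le> (18 * sqrt CARD('n)) * dist x y powr \<alpha>"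
proof -
  have "dist (v x) (v y) \<le> sqrt CARD('n) * infnorm (v x - v y)"
    using norm_le_infnorm[of "v x - v y"] by (simp add: dist_norm)
  also have "\<dots> \<le> sqrt CARD('n) * (18 * dist x y powr \<alpha>)"
  proof (rule mult_left_mono)
    have "infnorm (x - y) powr \<alpha> \<le> dist x y powr \<alpha>"
      using \<alpha> infnorm_le_norm[of "x - y"] by (intro powr_mono2) (auto simp: dist_norm infnorm_pos_le)
    then show "infnorm (v x - v y) \<le> 18 * dist x y powr \<alpha>" using v_holder_infnorm[OF assms] by simp
  qed simp
  finally show ?thesis by (simp add: mult_ac)
qed

lemma v_in_holder_space: "v \<in> holder_space \<alpha> (ball 0 1)"
proof -
  have "dist (v x) (v y) \<le> (18 * sqrt CARD('n)) * dist x y powr \<alpha>" if "x \<in> ball 0 1" "y \<in> ball 0 1" for x y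
    using that by (intro v_holder) auto
  then show ?thesis unfolding holder_space_def by blast
qed

lemma continuous_on_v: "continuous_on (cball 0 1) v"
  using \<alpha>(1) v_holder by (rule holder_imp_continuous_on)

text \<open>A bubble lies so close to the z-axis that the horizontal part of \<open>x\<close> has
  Euclidean norm at most 1/2. On the upper half of the sphere the cutoff in \<open>v\<close> is
  therefore 1 there.\<close>

lemma near_center_imp_high:
  assumes "norm x = 1" "center_dist k x < 2 * r k"
  shows "\<bar>x $ z\<bar> \<ge> 1 / 2"
proof -
  have "infnorm (flat z x) \<le> 10 * r k"
    using infnorm_flat_diff[of z x "x - center k"] infnorm_flat_diff[of z x "center k"] infnorm_flat_le[of z "center k"] infnorm_center[of k] assms(2)
    by (simp add: center_dist_def)
  also have "\<dots> \<le> (1 / sqrt CARD('n)) / 2"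
  proof -
    have "10 * r k \<le> B / 2" if "20 * r0 \<le> B" for B using that r_le[of k] by linarith
    then show ?thesis using r0(2) .
  qed
  finally have i: "infnorm (flat z x) \<le> (1 / sqrt CARD('n)) / 2" .
  have "norm (flat z x) \<le> sqrt CARD('n) * infnorm (flat z x)" using norm_le_infnorm[of "flat z x"] by simp
  also have "\<dots> \<le> sqrt CARD('n) * ((1 / sqrt CARD('n)) / 2)" using i by (rule mult_left_mono) simp
  also have "\<dots> = 1 / 2" using n2 by simp
  finally have f: "norm (flat z x) \<le> 1 / 2" .
  have "x = flat z x + axis z (x $ z)" by (simp add: flat_def axis_def vec_eq_iff)
  then have "norm x \<le> norm (flat z x) + norm (axis z (x $ z))" by (metis norm_triangle_ineq)
  moreover have "norm (axis z (x $ z)) = \<bar>x $ z\<bar>"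
  proof -
    have "axis z (x $ z) = (x $ z) *\<^sub>R axis z (1::real)" by (simp add: axis_def vec_eq_iff)
    then show ?thesis by (simp add: norm_axis_1)
  qed
  ultimately show ?thesis using f assms(1) by simp
qed

lemma v_on_sphere:
  assumes "norm x = 1" "0 < x $ z" "center_dist k x < 2 * r k"
  shows "v x = bubble k x"
proof -
  have "max 0 (min 1 (2 * x $ z)) = 1" using near_center_imp_high[OF assms(1,3)] assms(2) by simp
  then show ?thesis using bubble_sum_eq[OF assms(3)] by (simp add: v_def)
qed

text \<open>For \<open>j < k\<close> the heights differ by at least \<open>r j / 2\<close>, whereas
  \<open>s j + s k\<close> is at most a quarter of \<open>r j + r k\<close>.\<close>

lemma slab_separation:
  assumes "j \<noteq> k"
  shows "s j + s k \<le> \<bar>r j - r k\<bar>"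
proof -
  have "s a + s b \<le> r a - r b" if "a < b" for a b
    using r_half[OF that] s4[of a] s4[of b] r_pos[of a] r_pos[of b] by linarith
  from this[of j k] this[of k j] show ?thesis using assms by linarith
qed

text \<open>Off the k-th patch the value is 0, on a ramp along the z-axis, or in the slab of another
  pillow.\<close>

lemma v_off_patch:
  assumes x: "norm x = 1" and off: "\<not> (0 < x $ z \<and> center_dist k x < r k)"
  shows "flat z (v x) = 0 \<or> s k \<le> \<bar>v x $ z - r k\<bar>"
proof (cases "0 < x $ z \<and> (\<exists>j. center_dist j x < 2 * r j)")
  case False
  have "v x = 0"
  proof (cases "0 < x $ z")
    case True
    then have "bubble_sum x = 0" using False by (intro bubble_sum_eq_0) (auto simp: not_less)
    then show ?thesis by (simp add: v_def)
  qed (simp add: v_def)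
  then show ?thesis by (simp add: flat_def vec_eq_iff)
next
  case True
  then obtain j where j: "center_dist j x < 2 * r j" by blast
  have vx: "v x = bubble j x" using v_on_sphere x True j by blast
  show ?thesis
  proof (cases "center_dist j x < r j")
    case False
    then have "v x = axis z (plateau j x)" using vx by (simp add: bubble_def wrapped_outside)
    then show ?thesis by (simp add: flat_def axis_def vec_eq_iff)
  next
    case in_patch: True
    then have jk: "j \<noteq> k" using off True by auto
    let ?w = "wrap z (m j) (cube_to_pillow z ((x - center j) /\<^sub>R r j))"
    have "plateau j x = r j" using in_patch r_pos[of j] by (simp add: plateau_def)
    then have "v x $ z = r j + s j * ?w $ z" using vx by (simp add: bubble_def corner_def)
    moreover have "\<bar>?w $ z\<bar> \<le> 1" using pillow_infnorm_le_1[OF wrapped_in] by (auto simp: infnorm_le_iff)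
    then have "s j * \<bar>?w $ z\<bar> \<le> s j * 1" using s0[of j] by (intro mult_left_mono) auto
    then have "\<bar>s j * ?w $ z\<bar> \<le> s j" using s0[of j] by (simp add: abs_mult)
    ultimately have "\<bar>v x $ z - r j\<bar> \<le> s j" by simp
    then show ?thesis using slab_separation[OF jk] by linarith
  qed
qed

text \<open>The centre of the k-th pillow, whose corner \<open>axis z (r k)\<close> lies on the
  z-axis.\<close>

definition base_point :: "nat \<Rightarrow> real^'n" where
  "base_point k = axis z (r k) - s k *\<^sub>R corner z"

text \<open>The homotopy from \<open>v\<close> to the \<open>k\<close>-th bubble alone first projects the other bubbles to the
  \<open>z\<close>-axis and then contracts the axis to the base point of the \<open>k\<close>-th bubble.\<close>

lemma ball_degree_v:
  assumes w: "infnorm w < 1 / 2"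
  shows "ball_degree (closure_extension (ball 0 1) v) (base_point k + s k *\<^sub>R w) = 2 ^ (m k * (CARD('n) - 1))"
proof -
  let ?y = "base_point k + s k *\<^sub>R w" and ?cv = "closure_extension (ball 0 1) v"
  let ?P = "patch_map z (center k) (r k)"
  let ?F = "\<lambda>x. wrap z (m k) (?P x)"
  \<comment> \<open>\<open>T\<close> is the k-th bubble alone, constant off its patch;
    \<open>v1\<close> has the heights of \<open>v\<close> but only the horizontal displacement of
    the k-th pillow.\<close>
  define T where "T x = base_point k + s k *\<^sub>R ?F x" for x
  define v1 where "v1 x = axis z (v x $ z) + s k *\<^sub>R flat z (?F x - corner z)" for x
  have w_comp: "\<bar>w $ i\<bar> < 1 / 2" for i using w component_le_infnorm_cart[of w i] by linarith
  \<comment> \<open>The value is off the z-axis and, by \<open>yz\<close>, strictly inside the k-th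
    slab.\<close>
  have y1: "?y $ i1 \<noteq> 0"
  proof -
    have "?y $ i1 = s k * (w $ i1 - 1)" using i1 by (simp add: base_point_def axis_def corner_def algebra_simps)
    then show ?thesis using s0[of k] w_comp[of i1] by auto
  qed
  have yz: "\<bar>?y $ z - r k\<bar> < s k"
    using s0[of k] w_comp[of z] by (simp add: base_point_def corner_def abs_mult)
  have cF: "continuous_on (sphere 0 1) ?F"
    by (rule continuous_on_compose2[OF wrap_props(1) continuous_on_patch_map[OF r_pos center_bound]])
      (auto intro: patch_map_in)
  have cT: "continuous_on (sphere 0 1) T" unfolding T_def by (intro continuous_intros cF)
  have cv: "continuous_on (sphere 0 1) v" by (rule continuous_on_subset[OF continuous_on_v]) auto
  have cv1: "continuous_on (sphere 0 1) v1"
    unfolding v1_def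
  proof (intro continuous_intros)
    show "continuous_on (sphere 0 1) (\<lambda>x. axis z (v x $ z))"
      unfolding axis_def
    proof (rule continuous_on_vec_lambda)
      fix i show "continuous_on (sphere 0 1) (\<lambda>x. if i = z then v x $ z else 0)"
        by (cases "i = z") (auto intro!: continuous_intros cv)
    qed
    show "continuous_on (sphere 0 1) (\<lambda>x. flat z (?F x - corner z))"
      unfolding flat_def
    proof (rule continuous_on_vec_lambda)
      fix i show "continuous_on (sphere 0 1) (\<lambda>x. if i = z then 0 else (?F x - corner z) $ i)"
        by (cases "i = z") (auto intro!: continuous_intros cF)
    qed
  qed
  have Ty: "T x \<noteq> ?y" for x
  proof
    assume "T x = ?y"
    then have "?F x = w" using s0[of k] by (simp add: T_def)
    then have "pillow_norm z w = 1" using wrap_in[OF patch_map_in] by (metis (mono_tags, lifting) mem_Collect_eq pillow_def)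
    then show False using infnorm_flat_le[of z w] w w_comp[of z] by (simp add: pillow_norm_def)
  qed
  have on: "T x = v x \<and> v1 x = v x" if x: "norm x = 1" "0 < x $ z" "center_dist k x < r k" for x
  proof -
    have P: "?P x = cube_to_pillow z ((x - center k) /\<^sub>R r k)" using x by (simp add: patch_map_def)
    have "center_dist k x < 2 * r k" "plateau k x = r k" using x r_pos[of k] by (auto simp: plateau_def)
    then have vx: "v x = axis z (r k) + s k *\<^sub>R (?F x - corner z)"
      using v_on_sphere[OF x(1,2)] P by (simp add: bubble_def)
    then have "T x = v x" by (simp add: T_def base_point_def algebra_simps)
    moreover have "v1 x = v x"
      unfolding v1_def vx by (auto simp: vec_eq_iff axis_def flat_def)
    ultimately show ?thesis by blast
  qed
  have off: "T x = axis z (r k) \<and> v1 x = axis z (v x $ z)" if x: "\<not> (0 < x $ z \<and> center_dist k x < r k)" for x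
  proof -
    have "?P x = axis z (-1)"
    proof (cases "x $ z \<le> 0")
      case False
      then show ?thesis using x by (intro patch_map_outside[OF r_pos]) (auto simp: center_dist_def)
    qed (simp add: patch_map_def)
    then have "?F x = corner z" using wrap_axis[OF n2 m2] by simp
    then show ?thesis by (simp add: T_def v1_def base_point_def flat_def vec_eq_iff)
  qed
  \<comment> \<open>Off the patch \<open>v\<close> and \<open>v1\<close> have equal heights. Either
    both lie on the z-axis, which misses \<open>?y\<close>, or their common height is outside the
    open slab containing \<open>?y\<close>.\<close>
  have h1: "(1 - t) *\<^sub>R (v x - ?y) + t *\<^sub>R (v1 x - ?y) \<noteq> 0" if x: "norm x = 1" for x t
  proof (cases "0 < x $ z \<and> center_dist k x < r k")
    case True
    then have "v x = T x" "v1 x = T x" using on x by auto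
    then show ?thesis using Ty[of x] by (simp flip: scaleR_add_left)
  next
    case False
    note o = off[OF False]
    from v_off_patch[OF x False] show ?thesis
    proof
      assume "flat z (v x) = 0"
      then have "flat z (v x) $ i1 = 0" by simp
      then have "v x $ i1 = 0" using i1 by (simp add: flat_def)
      then have "((1 - t) *\<^sub>R (v x - ?y) + t *\<^sub>R (v1 x - ?y)) $ i1 = - ?y $ i1"
        using o i1 by (simp add: axis_def algebra_simps)
      then show ?thesis using y1 by (metis neg_equal_0_iff_equal zero_index)
    next
      assume "s k \<le> \<bar>v x $ z - r k\<bar>"
      then have "v x $ z \<noteq> ?y $ z" using yz by auto
      moreover have "((1 - t) *\<^sub>R (v x - ?y) + t *\<^sub>R (v1 x - ?y)) $ z = v x $ z - ?y $ z"
        using o by (simp add: algebra_simps)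
      ultimately show ?thesis by (metis eq_iff_diff_eq_0 zero_index)
    qed
  qed
  \<comment> \<open>Off the patch the whole segment lies on the z-axis.\<close>
  have h2: "(1 - t) *\<^sub>R (v1 x - ?y) + t *\<^sub>R (T x - ?y) \<noteq> 0" if x: "norm x = 1" for x t
  proof (cases "0 < x $ z \<and> center_dist k x < r k")
    case True
    then have "v1 x = T x" using on x by auto
    then show ?thesis using Ty[of x] by (simp flip: scaleR_add_left)
  next
    case False
    have "((1 - t) *\<^sub>R (v1 x - ?y) + t *\<^sub>R (T x - ?y)) $ i1 = - ?y $ i1"
      using off[OF False] i1 by (simp add: axis_def algebra_simps)
    then show ?thesis using y1 by (metis neg_equal_0_iff_equal zero_index)
  qed
  have cc: "?cv x = v x" if "x \<in> cball 0 1" for x by (rule closure_extension_eq[OF continuous_on_v that])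
  have "ball_degree ?cv ?y = sphere_degree (\<lambda>x. ?cv x - ?y)"
  proof (rule ball_degree_eq_sphere_degree)
    show "continuous_on (cball 0 1) ?cv" using continuous_on_v by (rule continuous_on_eq) (simp add: cc)
    show "?cv x \<noteq> ?y" if "norm x = 1" for x using h1[OF that, of 0] cc[of x] that by simp
  qed
  also have "\<dots> = sphere_degree (\<lambda>x. v x - ?y)" by (rule sphere_degree_cong) (simp add: cc)
  also have "\<dots> = sphere_degree (\<lambda>x. v1 x - ?y)"
    by (rule sphere_degree_linear_homotopy) (intro continuous_intros cv cv1 h1; assumption)+
  also have "\<dots> = sphere_degree (\<lambda>x. T x - ?y)"
    by (rule sphere_degree_linear_homotopy) (intro continuous_intros cT cv1 h2; assumption)+
  also have "\<dots> = 2 ^ (m k * (CARD('n) - 1))"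
    unfolding T_def by (rule sphere_degree_wrapped_patch[OF r_pos center_bound s0 w])
  finally show ?thesis .
qed

end

section \<open>Divergence of the integral\<close>

text \<open>The product equals
  \<open>\<rho> powr (\<alpha> * real n) * (2 powr \<delta>) ^ m\<close> with
  \<open>\<delta> > 0\<close>, so it outgrows every \<open>M\<close>; the bound on the size also
  holds for all large \<open>m\<close>.\<close>

lemma exists_wrapping_exponent:
  fixes \<rho> \<alpha> p M :: real
  assumes \<rho>: "0 < \<rho>" and \<alpha>: "0 < \<alpha>" and n: "1 \<le> n" and sub: "\<alpha> < p * (real n - 1) / real n"
  shows "\<exists>m\<ge>2. (\<rho> / 2 ^ m) powr \<alpha> \<le> \<rho> / 4 \<and> M \<le> (2 ^ (m * (n - 1))) powr p * ((\<rho> / 2 ^ m) powr \<alpha>) ^ n"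
proof -
  define \<delta> where "\<delta> = p * (real n - 1) - \<alpha> * real n"
  have \<delta>: "\<delta> > 0" using sub n by (simp add: \<delta>_def field_simps)
  have eq: "(2 ^ (m * (n - 1))) powr p * ((\<rho> / 2 ^ m) powr \<alpha>) ^ n = \<rho> powr (\<alpha> * real n) * (2 powr \<delta>) ^ m" for m
  proof -
    have "(2 ^ (m * (n - 1))) powr p = (2::real) powr (real m * (real n - 1) * p)"
      using n by (simp add: powr_realpow[symmetric] powr_powr of_nat_diff)
    moreover have "((\<rho> / 2 ^ m) powr \<alpha>) ^ n = \<rho> powr (\<alpha> * real n) * 2 powr (- real m * \<alpha> * real n)"
    proof -
      have "((\<rho> / 2 ^ m) powr \<alpha>) ^ n = (\<rho> / 2 ^ m) powr (\<alpha> * real n)"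
        using \<rho> by (simp add: powr_realpow[symmetric] powr_powr)
      also have "\<dots> = (\<rho> * 2 powr (- real m)) powr (\<alpha> * real n)" by (simp add: powr_minus powr_realpow divide_inverse)
      also have "\<dots> = \<rho> powr (\<alpha> * real n) * (2 powr (- real m)) powr (\<alpha> * real n)"
        by (rule powr_mult)
      finally show ?thesis by (simp add: powr_powr mult.assoc)
    qed
    moreover have "(2 powr \<delta>) ^ m = 2 powr (real m * (real n - 1) * p) * 2 powr (- real m * \<alpha> * real n)"
      by (simp add: powr_realpow[symmetric] powr_powr powr_add[symmetric] \<delta>_def algebra_simps)
    ultimately show ?thesis by simp
  qed
  have "(\<lambda>m. \<rho> / 2 ^ m) \<longlonglongrightarrow> 0" by (rule LIMSEQ_divide_realpow_zero) simp
  then have "(\<lambda>m. (\<rho> / 2 ^ m) powr \<alpha>) \<longlonglongrightarrow> 0"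
    by (rule tendsto_zero_powrI[OF _ tendsto_const _ \<alpha>]) (use \<rho> in simp)
  then have "\<forall>\<^sub>F m in sequentially. (\<rho> / 2 ^ m) powr \<alpha> < \<rho> / 4"
    by (rule order_tendstoD) (use \<rho> in simp)
  moreover have "\<forall>\<^sub>F m in sequentially. M / \<rho> powr (\<alpha> * real n) \<le> (2 powr \<delta>) ^ m"
  proof -
    have gt1: "1 < 2 powr \<delta>" using \<delta> by simp
    then obtain N where N: "M / \<rho> powr (\<alpha> * real n) < (2 powr \<delta>) ^ N" using real_arch_pow by blast
    show ?thesis
      using eventually_ge_at_top[of N]
    proof eventually_elim
      case (elim m)
      have "(2 powr \<delta>) ^ N \<le> (2 powr \<delta>) ^ m" using gt1 elim by (intro power_increasing) auto
      then show ?case using N by linarith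
    qed
  qed
  moreover have "\<forall>\<^sub>F m in sequentially. 2 \<le> m" by (rule eventually_ge_at_top)
  ultimately have "\<forall>\<^sub>F m in sequentially. 2 \<le> m \<and> (\<rho> / 2 ^ m) powr \<alpha> \<le> \<rho> / 4
      \<and> M \<le> \<rho> powr (\<alpha> * real n) * (2 powr \<delta>) ^ m"
    by eventually_elim (use \<rho> in \<open>simp add: field_simps\<close>)
  then obtain m where "2 \<le> m \<and> (\<rho> / 2 ^ m) powr \<alpha> \<le> \<rho> / 4 \<and> M \<le> \<rho> powr (\<alpha> * real n) * (2 powr \<delta>) ^ m"
    by (metis (mono_tags, lifting) eventually_sequentially order_refl)
  then show ?thesis unfolding eq by blast
qed

text \<open>These \<open>w\<close> form an open cube of side 1, so its image has volume
  \<open>s ^ CARD('n)\<close>.\<close>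

lemma integral_ge_on_cube:
  fixes f :: "real^'n::finite \<Rightarrow> real" and q :: "real^'n"
  assumes f: "integrable lebesgue f" "\<And>x. 0 \<le> f x" and s: "0 < s"
    and c: "\<And>w. infnorm w < 1 / 2 \<Longrightarrow> c \<le> f (q + s *\<^sub>R w)" and c0: "0 \<le> c"
  shows "c * s ^ CARD('n) \<le> integral\<^sup>L lebesgue f"
proof -
  define Q where "Q = box (q - (s / 2) *\<^sub>R One) (q + (s / 2) *\<^sub>R One)"
  have Qs: "Q \<in> sets lebesgue" unfolding Q_def by simp
  have "measure lborel Q = (\<Prod>b\<in>(Basis::(real^'n) set).
      ((q + (s / 2) *\<^sub>R One) - (q - (s / 2) *\<^sub>R One)) \<bullet> b)"
    unfolding Q_def by (rule measure_lborel_box) (use s in \<open>simp add: inner_diff_left inner_add_left\<close>)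
  also have "\<dots> = (\<Prod>b\<in>(Basis::(real^'n) set). s)"
    by (rule prod.cong[OF refl])
      (simp only: inner_diff_left inner_add_left inner_scaleR_left inner_sum_left_Basis, simp)
  finally have mQ: "measure lebesgue Q = s ^ CARD('n)" by (simp add: Q_def)
  have fin: "emeasure lebesgue Q < \<infinity>" unfolding Q_def by (simp add: emeasure_lborel_box_eq)
  have "c * indicator Q x \<le> f x" for x
  proof (cases "x \<in> Q")
    case True
    define w where "w = (x - q) /\<^sub>R s"
    obtain i where i: "infnorm w = \<bar>w $ i\<bar>" by (rule infnorm_attained)
    have "axis i 1 \<in> (Basis :: (real^'n) set)" by (simp add: axis_in_Basis_iff)
    then have "(q - (s / 2) *\<^sub>R One) \<bullet> axis i 1 < x \<bullet> axis i 1 \<and> x \<bullet> axis i 1 < (q + (s / 2) *\<^sub>R One) \<bullet> axis i 1"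
      using True unfolding Q_def mem_box by blast
    moreover have "One \<bullet> axis i (1::real) = 1" using \<open>axis i 1 \<in> Basis\<close> by simp
    ultimately have "\<bar>x $ i - q $ i\<bar> < s / 2" by (simp add: inner_diff_left inner_add_left inner_axis abs_if)
    moreover have "\<bar>w $ i\<bar> = \<bar>x $ i - q $ i\<bar> / s" using s by (simp add: w_def abs_mult divide_inverse mult.commute)
    ultimately have "infnorm w < 1 / 2" using s i by (simp add: pos_divide_less_eq)
    then have "c \<le> f (q + s *\<^sub>R w)" by (rule c)
    moreover have "q + s *\<^sub>R w = x" using s by (simp add: w_def)
    ultimately show ?thesis using True by simp
  qed (simp add: f)
  moreover have "integrable lebesgue (\<lambda>x. c * indicator Q x)"
    using Qs fin by simp
  ultimately have "integral\<^sup>L lebesgue (\<lambda>x. c * indicator Q x) \<le> integral\<^sup>L lebesgue f"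
    using f(1) by (intro integral_mono)
  then show ?thesis using Qs mQ by simp
qed

theorem theorem1p3:
  fixes p \<alpha> :: real
  assumes "CARD('n::finite) \<ge> 2"
    and "p \<ge> 1"
    and "0 < \<alpha>" and "\<alpha> \<le> 1"
    and "\<alpha> < p * (real CARD('n) - 1) / real CARD('n)"
  shows "\<exists>v :: real^'n \<Rightarrow> real^'n.
           v \<in> holder_space \<alpha> (ball 0 1) \<and>
           (\<lambda>y. real_of_int (ball_degree (closure_extension (ball 0 1) v) y))
             \<notin> Lp_space p (lebesgue :: (real^'n) measure)"
proof -
  let ?n = "CARD('n)"
  obtain z i1 :: 'n where i1: "i1 \<noteq> z"
    using assms(1) by (metis (full_types) UNIV_I card_2_iff' card_le_Suc0_iff_eq finite numeral_2_eq_2 not_less_eq_eq)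
  define r0 :: real where "r0 = 1 / (20 * sqrt ?n)"
  define r where "r k = r0 / 2 ^ k" for k
  have r0: "0 < r0" "20 * r0 \<le> 1 / sqrt ?n" by (simp_all add: r0_def)
  have rp: "0 < r k" for k using r0 by (simp add: r_def)
  \<comment> \<open>The radius \<open>r k\<close> is fixed first; the exponent is then so large that
    the k-th cube alone contributes at least \<open>k\<close>.\<close>
  have "\<exists>m\<ge>2. (r k / 2 ^ m) powr \<alpha> \<le> r k / 4 \<and>
      real k \<le> (2 ^ (m * (?n - 1))) powr p * ((r k / 2 ^ m) powr \<alpha>) ^ ?n" for k
    by (rule exists_wrapping_exponent[OF rp assms(3) _ assms(5)]) (use assms(1) in simp)
  then obtain m where m: "\<And>k. m k \<ge> 2" "\<And>k. (r k / 2 ^ m k) powr \<alpha> \<le> r k / 4"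
      "\<And>k. real k \<le> (2 ^ (m k * (?n - 1))) powr p * ((r k / 2 ^ m k) powr \<alpha>) ^ ?n" by metis
  \<comment> \<open>The largest size that \<open>s\<alpha>\<close> permits.\<close>
  define s where "s k = (r k / 2 ^ m k) powr \<alpha>" for k
  have sp: "0 < s k" for k using rp[of k] by (simp add: s_def)
  interpret bubbles z i1 \<alpha> r0 m r s
    by unfold_locales (use i1 assms r0 m sp in \<open>auto simp: r_def s_def\<close>)
  let ?deg = "\<lambda>y. real_of_int (ball_degree (closure_extension (ball 0 1) v) y)"
  have "?deg \<notin> Lp_space p lebesgue"
  proof
    assume "?deg \<in> Lp_space p lebesgue"
    then have int: "integrable lebesgue (\<lambda>y. \<bar>?deg y\<bar> powr p)" by (simp add: Lp_space_def)
    have "real k \<le> integral\<^sup>L lebesgue (\<lambda>y. \<bar>?deg y\<bar> powr p)" for k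
    proof -
      have "(2 ^ (m k * (?n - 1))) powr p * s k ^ ?n \<le> integral\<^sup>L lebesgue (\<lambda>y. \<bar>?deg y\<bar> powr p)"
        by (rule integral_ge_on_cube[OF int _ sp, where q = "base_point k"]) (simp_all add: ball_degree_v)
      then show ?thesis using m(3)[of k] by (simp add: s_def)
    qed
    then show False by (meson not_le reals_Archimedean2)
  qed
  then show ?thesis using v_in_holder_space by blast
qed

end
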